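(* Let $\{a_{t,1}:t\ge0\}$ and $\{a_{t,2}:t\ge0\}$ be two freely independent free Poisson processes with distributions $\kappa_n(a_{t,i})=t\alpha_i^n$, $n\ge1$, $i=1,2$. Then $\{a_t=a_{t,1}+a_{t,2}:t\ge0\}$ is a compound free Poisson process. Moreover, the sum process $\{a_t:t\ge0\}$ of two non-zero free Poisson processes (that is, $(\alpha_1)^2+(\alpha_2)^2\ne0$) is a free Poisson process if and only if $\alpha_1=\alpha_2$.
   Context: All elements lie in a $*$-non-commutative probability space $(\mathcal{A},\varphi)$ (a unital $*$-algebra with a positive unital linear functional), and $\alpha_1,\alpha_2\in\mathbb{R}$. $\kappa_n$ denotes the $n$-th free cumulant (defined via non-crossing partitions), and $\kappa_n(a):=\kappa_n(a,\dots,a)$. Two processes are freely independent if the unital subalgebras they generate are freely independent. Free Poisson process: for $k\in\mathbb{N}$ and $\alpha\in\mathbb{R}$, a family $\{X_t:t\ge0\}$ of self-adjoint elements is a free Poisson process if (1) $X_0=0$; (2) for $0\le t_1<\cdots<t_n<\infty$, the increments $X_{t_n}-X_{t_{n-1}},\dots,X_{t_2}-X_{t_1}$ form a freely independent family; (3) for $0\le s<t$, $\kappa_n(X_t-X_s)=k(t-s)\alpha^n$ for all $n\ge1$. "A free Poisson process" means one for some $k\in\mathbb{N}$ and some $\alpha\in\mathbb{R}$. Compound free Poisson process: for a compactly supported probability measure $\nu$ on $\mathbb{R}$ and $k\in\mathbb{N}$, a family $\{a_I:I=[s,t)\subset[0,\infty)\}$ of self-adjoint elements is a compound free Poisson process with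 respect to $\nu$ if (1) $\kappa_n(a_I)=k|I|m_n(\nu)$ for all $n\ge1$ and all $I$, where $|I|$ is the length of $I$ and $m_n(\nu)$ is the $n$-th moment of $\nu$; (2) for mutually disjoint half-open intervals $I_1,\dots,I_n$, the elements $a_{I_1},\dots,a_{I_n}$ form a freely independent family. A process $\{a_t:t\ge0\}$ is regarded as a family indexed by intervals through $a_{[s,t)}=a_t-a_s$. "A compound free Poisson process" means one with respect to some $\nu$ and some $k$.
   Formalization: The equivalence is stated for α1 ≠ 0 and α2 ≠ 0 instead of (α1)²+(α2)² ≠ 0; if exactly one of them is 0 (for example a_{t,1} = 0), the sum is a free Poisson process although α1 ≠ α2, so the printed condition makes the claim false. *)

theory Defs
  imports "HOL-Probability.Probability"
begin

section \<open>Star-non-commutative probability spaces\<close>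

class complex_star_algebra = ring_1 +
  fixes scaleC :: "complex \<Rightarrow> 'a \<Rightarrow> 'a"
    and adj :: "'a \<Rightarrow> 'a"
  assumes scaleC_add_right: "scaleC c (x + y) = scaleC c x + scaleC c y"
    and scaleC_add_left: "scaleC (c + d) x = scaleC c x + scaleC d x"
    and scaleC_scaleC: "scaleC c (scaleC d x) = scaleC (c * d) x"
    and scaleC_one: "scaleC 1 x = x"
    and mult_scaleC_left: "scaleC c x * y = scaleC c (x * y)"
    and mult_scaleC_right: "x * scaleC c y = scaleC c (x * y)"
    and adj_adj: "adj (adj x) = x"
    and adj_add: "adj (x + y) = adj x + adj y"
    and adj_scaleC: "adj (scaleC c x) = scaleC (cnj c) (adj x)"
    and adj_mult: "adj (x * y) = adj y * adj x"

locale star_prob_space =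
  fixes \<phi> :: "'a::complex_star_algebra \<Rightarrow> complex"
  assumes add: "\<phi> (x + y) = \<phi> x + \<phi> y"
    and scaleC: "\<phi> (scaleC c x) = c * \<phi> x"
    and unital: "\<phi> 1 = 1"
    and positive: "\<phi> (adj x * x) \<in> \<real>\<^sub>\<ge>\<^sub>0"

section \<open>Free cumulants\<close>

definition noncrossing :: "nat set set \<Rightarrow> bool" where
  "noncrossing \<pi> \<longleftrightarrow>
     (\<forall>V\<in>\<pi>. \<forall>W\<in>\<pi>. \<forall>a\<in>V. \<forall>b\<in>W. \<forall>c\<in>V. \<forall>d\<in>W. a < b \<and> b < c \<and> c < d \<longrightarrow> V = W)"

definition NC :: "nat \<Rightarrow> nat set set set" where
  "NC n = {\<pi>. partition_on {..<n} \<pi> \<and> noncrossing \<pi>}"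

lemma finite_NC: "finite (NC n)"
proof (rule finite_subset)
  show "NC n \<subseteq> Pow (Pow {..<n})"
    by (auto simp: NC_def partition_on_def)
qed simp

lemma NC_block_less:
  assumes "\<pi> \<in> NC (length xs) - {{{..<length xs}}}" "V \<in> \<pi>"
  shows "length (nths xs V) < length xs"
proof -
  have part: "partition_on {..<length xs} \<pi>" and ne: "\<pi> \<noteq> {{..<length xs}}"
    using assms(1) by (auto simp: NC_def)
  have sub: "V \<subseteq> {..<length xs}"
    using part assms(2) by (auto simp: partition_on_def)
  have "V \<noteq> {..<length xs}"
  proof
    assume V: "V = {..<length xs}"
    have "W = V" if "W \<in> \<pi>" for W
    proof (rule ccontr)
      assume "W \<noteq> V"
      then have "W \<inter> V = {}"
        using part that assms(2) by (auto simp: partition_on_def disjoint_def)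
      moreover have "W \<subseteq> V" "W \<noteq> {}"
        using part that V by (auto simp: partition_on_def)
      ultimately show False by blast
    qed
    then show False using ne assms(2) V by blast
  qed
  then have "card V < card {..<length xs}"
    using sub by (intro psubset_card_mono) auto
  moreover have "{i. i < length xs \<and> i \<in> V} = V" using sub by auto
  ultimately show ?thesis by (simp add: length_nths)
qed

text \<open>
  \<open>free_cumulant \<phi> [a\<^sub>1, \<dots>, a\<^sub>n]\<close> is \<open>\<kappa>\<^sub>n(a\<^sub>1, \<dots>, a\<^sub>n)\<close>. The free cumulants are determined
  recursively by the moment-cumulant formula
  \<open>\<phi>(a\<^sub>1 \<cdots> a\<^sub>n) = (\<Sum>\<pi>\<in>NC n. \<Prod>V\<in>\<pi>. \<kappa>(a | V))\<close>, solved for the term of the one-block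
  partition; \<open>nths\<close> lists the entries at the positions in \<open>V\<close> in increasing order.
\<close>
function free_cumulant :: "('a::complex_star_algebra \<Rightarrow> complex) \<Rightarrow> 'a list \<Rightarrow> complex" where
  "free_cumulant \<phi> xs =
     \<phi> (prod_list xs)
     - (\<Sum>\<pi> \<in> NC (length xs) - {{{..<length xs}}}. \<Prod>V\<in>\<pi>. free_cumulant \<phi> (nths xs V))"
  by pat_completeness auto
termination
  by (relation "Wellfounded.measure (\<lambda>(\<phi>, xs). length xs)") (use NC_block_less in auto)

declare free_cumulant.simps [simp del]

lemma moment_cumulant:
  assumes "xs \<noteq> []"
  shows "\<phi> (prod_list xs) = (\<Sum>\<pi> \<in> NC (length xs). \<Prod>V\<in>\<pi>. free_cumulant \<phi> (nths xs V))"
proof -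
  let ?top = "{{..<length xs}}"
  have "?top \<in> NC (length xs)"
    using assms by (auto simp: NC_def noncrossing_def partition_on_def)
  moreover have "nths xs {..<length xs} = xs"
    by (simp add: nths_all)
  ultimately have "(\<Sum>\<pi> \<in> NC (length xs). \<Prod>V\<in>\<pi>. free_cumulant \<phi> (nths xs V))
      = free_cumulant \<phi> xs
        + (\<Sum>\<pi> \<in> NC (length xs) - {?top}. \<Prod>V\<in>\<pi>. free_cumulant \<phi> (nths xs V))"
    by (simp add: sum.remove[OF finite_NC])
  then show ?thesis by (simp add: free_cumulant.simps[of \<phi> xs])
qed

definition kappa :: "('a::complex_star_algebra \<Rightarrow> complex) \<Rightarrow> nat \<Rightarrow> 'a \<Rightarrow> complex" where
  "kappa \<phi> n a = free_cumulant \<phi> (replicate n a)"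

section \<open>Free independence\<close>

inductive_set gen_algebra :: "'a::complex_star_algebra set \<Rightarrow> 'a set" for S where
  one: "1 \<in> gen_algebra S"
| base: "x \<in> S \<Longrightarrow> x \<in> gen_algebra S"
| add: "x \<in> gen_algebra S \<Longrightarrow> y \<in> gen_algebra S \<Longrightarrow> x + y \<in> gen_algebra S"
| scaleC: "x \<in> gen_algebra S \<Longrightarrow> scaleC c x \<in> gen_algebra S"
| mult: "x \<in> gen_algebra S \<Longrightarrow> y \<in> gen_algebra S \<Longrightarrow> x * y \<in> gen_algebra S"

definition free_subalgebras ::
  "('a::complex_star_algebra \<Rightarrow> complex) \<Rightarrow> 'i set \<Rightarrow> ('i \<Rightarrow> 'a set) \<Rightarrow> bool" where
  "free_subalgebras \<phi> I B \<longleftrightarrow>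
     (\<forall>n i x. n > 0 \<and>
        (\<forall>j<n. i j \<in> I \<and> x j \<in> B (i j) \<and> \<phi> (x j) = 0) \<and>
        (\<forall>j. Suc j < n \<longrightarrow> i j \<noteq> i (Suc j))
        \<longrightarrow> \<phi> (prod_list (map x [0..<n])) = 0)"

definition free_elements ::
  "('a::complex_star_algebra \<Rightarrow> complex) \<Rightarrow> 'i set \<Rightarrow> ('i \<Rightarrow> 'a) \<Rightarrow> bool" where
  "free_elements \<phi> I x \<longleftrightarrow> free_subalgebras \<phi> I (\<lambda>i. gen_algebra {x i})"

text \<open>Processes are functions on \<open>real\<close> of which only the values at times \<open>t \<ge> 0\<close> matter.\<close>

definition free_processes ::
  "('a::complex_star_algebra \<Rightarrow> complex) \<Rightarrow> (real \<Rightarrow> 'a) \<Rightarrow> (real \<Rightarrow> 'a) \<Rightarrow> bool" where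
  "free_processes \<phi> X Y \<longleftrightarrow>
     free_subalgebras \<phi> UNIV (\<lambda>b::bool. gen_algebra ((if b then Y else X) ` {0..}))"

section \<open>Free Poisson and compound free Poisson processes\<close>

definition free_poisson_process_with ::
  "('a::complex_star_algebra \<Rightarrow> complex) \<Rightarrow> nat \<Rightarrow> real \<Rightarrow> (real \<Rightarrow> 'a) \<Rightarrow> bool" where
  "free_poisson_process_with \<phi> k \<alpha> X \<longleftrightarrow>
     (\<forall>t\<ge>0. adj (X t) = X t) \<and>
     X 0 = 0 \<and>
     (\<forall>n t. 0 \<le> t 0 \<and> (\<forall>i<n. t i < t (Suc i)) \<longrightarrow>
        free_elements \<phi> {..<n} (\<lambda>i. X (t (Suc i)) - X (t i))) \<and>
     (\<forall>s t. 0 \<le> s \<and> s < t \<longrightarrow>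
        (\<forall>n\<ge>1. kappa \<phi> n (X t - X s) = complex_of_real (real k * (t - s) * \<alpha> ^ n)))"

definition free_poisson_process ::
  "('a::complex_star_algebra \<Rightarrow> complex) \<Rightarrow> (real \<Rightarrow> 'a) \<Rightarrow> bool" where
  "free_poisson_process \<phi> X \<longleftrightarrow> (\<exists>k\<ge>1. \<exists>\<alpha>. free_poisson_process_with \<phi> k \<alpha> X)"

definition compactly_supported :: "real measure \<Rightarrow> bool" where
  "compactly_supported \<nu> \<longleftrightarrow> (\<exists>K. compact K \<and> (AE x in \<nu>. x \<in> K))"

text \<open>
  A family indexed by the half-open intervals \<open>[s, t)\<close> with \<open>0 \<le> s < t\<close> is encoded as a function
  \<open>a\<close> of the two endpoints.
\<close>
definition compound_free_poisson_family_with ::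
  "('a::complex_star_algebra \<Rightarrow> complex) \<Rightarrow> real measure \<Rightarrow> nat \<Rightarrow> (real \<Rightarrow> real \<Rightarrow> 'a) \<Rightarrow> bool"
  where
  "compound_free_poisson_family_with \<phi> \<nu> k a \<longleftrightarrow>
     (\<forall>s t. 0 \<le> s \<and> s < t \<longrightarrow> adj (a s t) = a s t) \<and>
     (\<forall>s t. 0 \<le> s \<and> s < t \<longrightarrow>
        (\<forall>n\<ge>1. kappa \<phi> n (a s t) = complex_of_real (real k * (t - s) * (\<integral>x. x ^ n \<partial>\<nu>)))) \<and>
     (\<forall>(n::nat) s t. (\<forall>i<n. 0 \<le> s i \<and> s i < t i) \<and>
        disjoint_family_on (\<lambda>i. {s i..<t i}) {..<n} \<longrightarrow>
        free_elements \<phi> {..<n} (\<lambda>i. a (s i) (t i)))"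

definition compound_free_poisson_process ::
  "('a::complex_star_algebra \<Rightarrow> complex) \<Rightarrow> (real \<Rightarrow> 'a) \<Rightarrow> bool" where
  "compound_free_poisson_process \<phi> X \<longleftrightarrow>
     (\<exists>\<nu> k. real_distribution \<nu> \<and> compactly_supported \<nu> \<and> k \<ge> 1 \<and>
        compound_free_poisson_family_with \<phi> \<nu> k (\<lambda>s t. X t - X s))"

end

theory Submission
  imports Defs "HOL-Computational_Algebra.Formal_Power_Series"
begin

text \<open>
  Why the result holds. For freely independent \<open>u\<close> and \<open>v\<close> the free cumulants add,
  \<open>\<kappa>\<^sub>n(u + v) = \<kappa>\<^sub>n(u) + \<kappa>\<^sub>n(v)\<close> (\<open>kappa_add_free\<close>), so over \<open>[s, t)\<close> the increment of the sum
  process has \<open>n\<close>-th cumulant \<open>(t - s) (\<alpha>1\<^sup>n + \<alpha>2\<^sup>n)\<close>. This equals \<open>2 (t - s)\<close> times the \<open>n\<close>-th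
  moment of the uniform distribution \<open>\<nu>\<close> on the two points \<open>\<alpha>1, \<alpha>2\<close>, so the sum is compound free
  Poisson with respect to \<open>\<nu>\<close> and \<open>k = 2\<close>, once its increments over disjoint intervals are known to
  be free. If \<open>\<alpha>1 = \<alpha>2\<close> then \<open>\<nu>\<close> is a point mass and the process is free Poisson. Conversely, if
  \<open>c \<beta>\<^sup>n = \<alpha>1\<^sup>n + \<alpha>2\<^sup>n\<close> for all \<open>n\<close>, then the power sums \<open>p\<^sub>n = \<alpha>1\<^sup>n + \<alpha>2\<^sup>n\<close> satisfy
  \<open>p\<^sub>1 p\<^sub>3 = p\<^sub>2\<^sup>2\<close>, that is, \<open>\<alpha>1 \<alpha>2 (\<alpha>1 - \<alpha>2)\<^sup>2 = 0\<close> (\<open>power_sums_scaled_geometric\<close>).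

  Additivity of cumulants is proved by generating functions, without mixed cumulants. With
  \<open>M(z) = \<Sum> \<phi>(x\<^sup>n) z\<^sup>n\<close> and \<open>C(z) = 1 + \<Sum> \<kappa>\<^sub>n(x) z\<^sup>n\<close>, splitting a non-crossing partition at
  the block of its first point turns the moment-cumulant formula into \<open>M(z) = C(z M(z))\<close>
  (\<open>NC_weight_functional_equation\<close>). Inverting this relation shows that \<open>C\<close> is the only power series
  with constant term \<open>1\<close> for which the resolvent \<open>(C(z) - z x)\<inverse>\<close>, a power series with coefficients in
  the algebra, has expectation \<open>1\<close> (\<open>expect_resolvent_fps_eq_1_iff\<close>). For free \<open>u\<close> and \<open>v\<close> write
  \<open>A\<^sub>u = C\<^sub>u(z) - z u\<close>, with inverse \<open>1 - E\<^sub>u\<close>, and likewise for \<open>v\<close>. All coefficients of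
  \<open>E\<^sub>u\<close> and \<open>E\<^sub>v\<close> are centered, and
  \<open>A\<^sub>u + A\<^sub>v - 1 = A\<^sub>u (1 - E\<^sub>u E\<^sub>v) A\<^sub>v\<close>. The inverse of the right-hand side is
  \<open>(1 - E\<^sub>v) (\<Sum> (E\<^sub>u E\<^sub>v)\<^sup>k) (1 - E\<^sub>u)\<close>; it consists of \<open>1\<close> and alternating products of \<open>E\<^sub>u\<close>
  and \<open>E\<^sub>v\<close>, so freeness gives it expectation \<open>1\<close>. As the left-hand side is
  \<open>(C\<^sub>u + C\<^sub>v - 1)(z) - z (u + v)\<close>, uniqueness yields \<open>C\<^sub>u\<^sub>+\<^sub>v = C\<^sub>u + C\<^sub>v - 1\<close>.

  Freeness of the increments of the sum is the associativity of free independence. Families that are free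
  inside free algebras are jointly free (\<open>free_subalgebras_join\<close>), and a free family may be grouped
  (\<open>free_subalgebras_group\<close>); the increments of each summand over disjoint intervals are free because
  those intervals are cells of the subdivision by all endpoints (\<open>free_increments_disjoint\<close>).
\<close>

unbundle no vec_syntax
unbundle fps_syntax

section \<open>Weighted enumeration of non-crossing partitions\<close>

definition NC_on :: "nat set \<Rightarrow> nat set set set" where
  "NC_on A = {\<pi>. partition_on A \<pi> \<and> noncrossing \<pi>}"

definition NC_weight :: "(nat \<Rightarrow> 'b::comm_ring_1) \<Rightarrow> nat set \<Rightarrow> 'b" where
  "NC_weight f A = (\<Sum>\<pi>\<in>NC_on A. \<Prod>V\<in>\<pi>. f (card V))"

lemma finite_NC_on: "finite A \<Longrightarrow> finite (NC_on A)"
  by (rule finite_subset[of _ "Pow (Pow A)"]) (auto simp: NC_on_def partition_on_def)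

lemma noncrossing_subset: "noncrossing \<pi> \<Longrightarrow> \<sigma> \<subseteq> \<pi> \<Longrightarrow> noncrossing \<sigma>"
  unfolding noncrossing_def by blast

lemma NC_on_image:
  fixes h :: "nat \<Rightarrow> nat"
  assumes "strict_mono h"
  shows "NC_on (h ` A) = (`) ((`) h) ` NC_on A"
proof -
  have inj: "inj h" using assms by (rule strict_mono_imp_inj_on)
  have nc: "noncrossing ((`) h ` \<sigma>) \<longleftrightarrow> noncrossing \<sigma>" for \<sigma>
    unfolding noncrossing_def
    by (simp add: strict_mono_less[OF assms] inj_image_eq_iff[OF inj])
  have fwd: "(`) h ` \<sigma> \<in> NC_on (h ` A)" if "\<sigma> \<in> NC_on A" for \<sigma>
  proof -
    have "partition_on (h ` A) ((`) h ` \<sigma> - {{}})"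
      using that inj by (intro partition_on_inj_image) (auto simp: NC_on_def inj_on_def)
    moreover have "{} \<notin> (`) h ` \<sigma>"
      using that by (auto simp: NC_on_def partition_on_def)
    ultimately show ?thesis using that nc by (simp add: NC_on_def)
  qed
  have bwd: "\<exists>\<sigma>\<in>NC_on A. \<tau> = (`) h ` \<sigma>" if "\<tau> \<in> NC_on (h ` A)" for \<tau>
  proof
    let ?\<sigma> = "(`) (inv h) ` \<tau>"
    have sub: "W \<subseteq> h ` A" if "W \<in> \<tau>" for W
      using that \<open>\<tau> \<in> _\<close> by (auto simp: NC_on_def partition_on_def)
    have "h ` inv h ` W = W" if "W \<in> \<tau>" for W
      using sub[OF that] inj by (force simp: image_image)
    then show eq: "\<tau> = (`) h ` ?\<sigma>"
      by (simp add: image_image cong: image_cong)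
    have "partition_on (inv h ` h ` A) (?\<sigma> - {{}})"
      using that inj by (intro partition_on_inj_image) (auto simp: NC_on_def inj_on_def)
    moreover have "{} \<notin> ?\<sigma>"
      using that by (auto simp: NC_on_def partition_on_def)
    moreover have "inv h ` h ` A = A" using inj by (simp add: image_image)
    moreover have "noncrossing ?\<sigma>" using that eq nc[of ?\<sigma>] by (simp add: NC_on_def)
    ultimately show "?\<sigma> \<in> NC_on A" by (simp add: NC_on_def)
  qed
  show ?thesis using fwd bwd by blast
qed

text \<open>
  Non-crossing partitions see only the order of the points, so the weight depends only on the number of
  points. This is what turns sums over partitions into convolutions.
\<close>
lemma NC_weight_image:
  assumes "strict_mono (h :: nat \<Rightarrow> nat)"
  shows "NC_weight f (h ` A) = NC_weight f A"
proof -
  have inj: "inj h" using assms by (rule strict_mono_imp_inj_on)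
  have inj': "inj ((`) h)" by (rule injI) (simp add: inj_image_eq_iff[OF inj])
  have inj'': "inj_on ((`) ((`) h)) S" for S
    by (rule inj_onI) (simp add: inj_image_eq_iff[OF inj'])
  have "(\<Prod>W\<in>(`) h ` \<sigma>. f (card W)) = (\<Prod>V\<in>\<sigma>. f (card V))" for \<sigma>
  proof -
    have "inj_on ((`) h) \<sigma>" using inj' by (rule inj_on_subset) simp
    then show ?thesis
      by (subst prod.reindex) (auto simp: card_image inj_on_subset[OF inj])
  qed
  then show ?thesis
    unfolding NC_weight_def NC_on_image[OF assms] by (simp add: sum.reindex[OF inj''])
qed

lemma NC_weight_interval: "NC_weight f {k..<k + m} = NC_weight f {..<m}"
proof -
  have "{k..<k + m} = (+) k ` {..<m}"
    by (simp add: lessThan_atLeast0 add.commute)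
  then show ?thesis by (simp add: NC_weight_image strict_mono_def)
qed

text \<open>
  The pair \<open>(V, \<rho>)\<close> stands for a non-crossing partition of \<open>{..<n}\<close> whose block at \<open>0\<close> is \<open>V\<close> and
  whose other blocks are \<open>\<rho>\<close>. For \<open>n = 0\<close> the empty root \<open>V = {}\<close> is admitted; this makes the
  recursion for the weights start at \<open>s = 0\<close> and lets the weight sequence for \<open>s\<close> be an \<open>s\<close>-th power.
\<close>
definition rooted_NC :: "nat \<Rightarrow> nat \<Rightarrow> (nat set \<times> nat set set) set" where
  "rooted_NC n s = {(V, \<rho>). V \<subseteq> {..<n} \<and> partition_on ({..<n} - V) \<rho> \<and>
     noncrossing (insert V \<rho>) \<and> (n > 0 \<longrightarrow> 0 \<in> V) \<and> card V = s}"

text \<open>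
  The root is not weighted here: its factor depends only on \<open>s\<close> and is supplied when summing over \<open>s\<close>.
\<close>
definition rooted_weight :: "(nat \<Rightarrow> 'b::comm_ring_1) \<Rightarrow> nat \<Rightarrow> nat \<Rightarrow> 'b" where
  "rooted_weight f n s = (\<Sum>(V, \<rho>)\<in>rooted_NC n s. \<Prod>W\<in>\<rho>. f (card W))"

lemma finite_rooted_NC: "finite (rooted_NC n s)"
  by (rule finite_subset[of _ "Pow {..<n} \<times> Pow (Pow {..<n})"])
    (auto simp: rooted_NC_def partition_on_def)

lemma rooted_weight_0: "rooted_weight f n 0 = (if n = 0 then 1 else 0)"
proof -
  have "(V, \<rho>) \<in> rooted_NC n 0 \<longleftrightarrow> n = 0 \<and> V = {} \<and> \<rho> = {}" for V \<rho>
  proof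
    assume *: "(V, \<rho>) \<in> rooted_NC n 0"
    then have "V \<subseteq> {..<n}" "card V = 0" by (auto simp: rooted_NC_def)
    then have "V = {}" by (meson card_0_eq finite_lessThan finite_subset)
    then show "n = 0 \<and> V = {} \<and> \<rho> = {}"
      using * by (cases n) (auto simp: rooted_NC_def partition_on_empty)
  qed (auto simp: rooted_NC_def partition_on_empty noncrossing_def)
  then have "rooted_NC n 0 = (if n = 0 then {({}, {})} else {})" by auto
  then show ?thesis by (simp add: rooted_weight_def)
qed

text \<open>
  Sorting the partitions by the size of the block that contains \<open>0\<close>.
\<close>
lemma NC_weight_first_block:
  assumes "n > 0"
  shows "NC_weight f {..<n} = (\<Sum>s\<le>n. f s * rooted_weight f n s)"
proof -
  define R where "R = (\<Union>s\<le>n. rooted_NC n s)"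
  have R: "(V, \<rho>) \<in> R \<longleftrightarrow> V \<subseteq> {..<n} \<and> partition_on ({..<n} - V) \<rho> \<and>
     noncrossing (insert V \<rho>) \<and> 0 \<in> V" for V \<rho>
    using assms card_mono[of "{..<n}" V] by (auto simp: R_def rooted_NC_def)
  have fresh: "V \<notin> \<rho>" if "(V, \<rho>) \<in> R" for V \<rho>
    using that unfolding R partition_on_def by blast
  have rootedI: "(V, \<pi> - {V}) \<in> R" if "\<pi> \<in> NC_on {..<n}" "V \<in> \<pi>" "0 \<in> V" for V \<pi>
  proof -
    have p: "partition_on {..<n} (insert V (\<pi> - {V}))" "noncrossing \<pi>"
      using that by (auto simp: NC_on_def insert_absorb)
    have "disjnt V (\<Union>(\<pi> - {V}))"
      using that by (auto simp: NC_on_def partition_on_def disjnt_def disjoint_def)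
    then have "partition_on ({..<n} - V) (\<pi> - {V}) \<and> V \<subseteq> {..<n}"
      using p(1) by (simp only: partition_on_insert)
    then show ?thesis
      using p(2) that unfolding R by (simp add: insert_absorb)
  qed
  have "(\<Sum>s\<le>n. f s * rooted_weight f n s)
      = (\<Sum>s\<le>n. \<Sum>(V, \<rho>)\<in>rooted_NC n s. f (card V) * (\<Prod>W\<in>\<rho>. f (card W)))"
    unfolding rooted_weight_def sum_distrib_left
    by (intro sum.cong refl) (auto simp: rooted_NC_def)
  also have "\<dots> = (\<Sum>(V, \<rho>)\<in>R. f (card V) * (\<Prod>W\<in>\<rho>. f (card W)))"
    unfolding R_def
    by (rule sum.UNION_disjoint[symmetric]) (use finite_rooted_NC in \<open>auto simp: rooted_NC_def\<close>)
  also have "\<dots> = NC_weight f {..<n}"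
    unfolding NC_weight_def
  proof (rule sum.reindex_bij_witness[where
      j = "\<lambda>(V, \<rho>). insert V \<rho>"
      and i = "\<lambda>\<pi>. (THE V. V \<in> \<pi> \<and> 0 \<in> V, \<pi> - {THE V. V \<in> \<pi> \<and> 0 \<in> V})"])
    fix p assume p: "p \<in> R"
    obtain V \<rho> where [simp]: "p = (V, \<rho>)" by fastforce
    have disj: "disjnt V (\<Union>\<rho>)" and V0: "0 \<in> V"
      using p unfolding \<open>p = _\<close> R partition_on_def disjnt_def by auto
    have the: "(THE U. U \<in> insert V \<rho> \<and> 0 \<in> U) = V"
      using disj V0 by (intro the_equality) (auto simp: disjnt_def)
    show "(THE V. V \<in> (case p of (V, \<rho>) \<Rightarrow> insert V \<rho>) \<and> 0 \<in> V,
         (case p of (V, \<rho>) \<Rightarrow> insert V \<rho>) - {THE V. V \<in> (case p of (V, \<rho>) \<Rightarrow> insert V \<rho>) \<and> 0 \<in> V}) = p"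
      using the fresh p by simp
    show "(case p of (V, \<rho>) \<Rightarrow> insert V \<rho>) \<in> NC_on {..<n}"
      using p disj V0 by (auto simp: R NC_on_def partition_on_insert)
    have "finite \<rho>"
      using p finite_elements[of "{..<n} - V" \<rho>] by (simp add: R)
    then show "(\<Prod>W\<in>(case p of (V, \<rho>) \<Rightarrow> insert V \<rho>). f (card W))
        = (case p of (V, \<rho>) \<Rightarrow> f (card V) * (\<Prod>W\<in>\<rho>. f (card W)))"
      using fresh p by simp
  next
    fix \<pi> assume \<pi>: "\<pi> \<in> NC_on {..<n}"
    then obtain V where V: "V \<in> \<pi>" "0 \<in> V"
      using assms unfolding NC_on_def partition_on_def by blast
    have "(THE V. V \<in> \<pi> \<and> 0 \<in> V) = V"
      using \<pi> V by (intro the_equality) (auto simp: NC_on_def partition_on_def disjoint_def)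
    then show "(case (THE V. V \<in> \<pi> \<and> 0 \<in> V, \<pi> - {THE V. V \<in> \<pi> \<and> 0 \<in> V}) of
        (V, \<rho>) \<Rightarrow> insert V \<rho>) = \<pi>"
      and "(THE V. V \<in> \<pi> \<and> 0 \<in> V, \<pi> - {THE V. V \<in> \<pi> \<and> 0 \<in> V}) \<in> R"
      using V rootedI[OF \<pi>] by auto
  qed
  finally show ?thesis ..
qed

text \<open>
  Cutting at the largest element \<open>l\<close> of the root \<open>V\<close>: since \<open>0\<close> and \<open>l\<close> both lie in \<open>V\<close>, a
  non-crossing partition has no block with points on both sides of \<open>l\<close>. To the left of \<open>l\<close> remains a rooted
  partition with one root point fewer, to the right an arbitrary non-crossing partition.
\<close>
lemma rooted_weight_Suc:
  "rooted_weight f n (Suc s) = (\<Sum>l<n. rooted_weight f l s * NC_weight f {..<n - Suc l})"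
proof -
  define S where "S = (SIGMA l:{..<n}. rooted_NC l s \<times> NC_on {Suc l..<n})"
  define glue :: "nat \<times> (nat set \<times> nat set set) \<times> nat set set \<Rightarrow> nat set \<times> nat set set"
    where "glue = (\<lambda>(l, (V, \<rho>), \<tau>). (insert l V, \<rho> \<union> \<tau>))"
  define cut :: "nat set \<times> nat set set \<Rightarrow> nat \<times> (nat set \<times> nat set set) \<times> nat set set"
    where "cut = (\<lambda>(V, \<rho>). (Max V, (V - {Max V}, {W\<in>\<rho>. W \<subseteq> {..<Max V}}),
      {W\<in>\<rho>. W \<subseteq> {Suc (Max V)..<n}}))"
  have "(\<Sum>l<n. rooted_weight f l s * NC_weight f {..<n - Suc l})
      = (\<Sum>l<n. rooted_weight f l s * NC_weight f {Suc l..<n})"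
  proof (intro sum.cong refl)
    fix l assume "l \<in> {..<n}"
    then show "rooted_weight f l s * NC_weight f {..<n - Suc l}
        = rooted_weight f l s * NC_weight f {Suc l..<n}"
      using NC_weight_interval[of f "Suc l" "n - Suc l"] by simp
  qed
  also have "\<dots> = (\<Sum>l<n. \<Sum>(p, \<tau>)\<in>rooted_NC l s \<times> NC_on {Suc l..<n}.
      (\<Prod>W\<in>snd p. f (card W)) * (\<Prod>W\<in>\<tau>. f (card W)))"
    by (simp add: rooted_weight_def NC_weight_def sum_product sum.cartesian_product case_prod_beta)
  also have "\<dots> = (\<Sum>(l, p, \<tau>)\<in>S. (\<Prod>W\<in>snd p. f (card W)) * (\<Prod>W\<in>\<tau>. f (card W)))"
    unfolding S_def
    by (subst sum.Sigma) (auto simp: finite_rooted_NC finite_NC_on)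
  also have "\<dots> = rooted_weight f n (Suc s)"
    unfolding rooted_weight_def
  proof (rule sum.reindex_bij_witness[where j = glue and i = cut])
    fix x assume "x \<in> S"
    then obtain l V \<rho> \<tau> where x[simp]: "x = (l, (V, \<rho>), \<tau>)" and l: "l < n"
      and V: "V \<subseteq> {..<l}" and \<rho>: "partition_on ({..<l} - V) \<rho>"
      and nc: "noncrossing (insert V \<rho>)" and V0: "l > 0 \<Longrightarrow> 0 \<in> V" and s: "card V = s"
      and \<tau>: "partition_on {Suc l..<n} \<tau>" "noncrossing \<tau>"
      by (auto simp: S_def rooted_NC_def NC_on_def)
    have finV: "finite V" using V by (rule finite_subset) simp
    have Max: "Max (insert l V) = l"
      using V finV by (intro Max_eqI) auto
    have \<rho>sub: "W \<subseteq> {..<l}" "W \<noteq> {}" "W \<inter> V = {}" if "W \<in> \<rho>" for W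
      using \<rho> that by (auto simp: partition_on_def)
    have \<tau>sub: "W \<subseteq> {Suc l..<n}" "W \<noteq> {}" if "W \<in> \<tau>" for W
      using \<tau> that by (auto simp: partition_on_def)
    have low: "{W\<in>\<rho> \<union> \<tau>. W \<subseteq> {..<l}} = \<rho>"
      using \<rho>sub \<tau>sub by fastforce
    have up: "{W\<in>\<rho> \<union> \<tau>. W \<subseteq> {Suc l..<n}} = \<tau>"
      using \<rho>sub \<tau>sub by fastforce
    have disj: "\<rho> \<inter> \<tau> = {}"
      using \<rho>sub \<tau>sub by fastforce
    have lV: "l \<notin> V" using V by auto
    show "cut (glue x) = x"
      using Max low up lV by (simp add: cut_def glue_def)
    have fin: "finite \<rho>" "finite \<tau>"
      using finite_elements[OF _ \<rho>] finite_elements[OF _ \<tau>(1)] by simp_all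
    show "(case glue x of (V, \<rho>) \<Rightarrow> \<Prod>W\<in>\<rho>. f (card W))
        = (case x of (l, p, \<tau>) \<Rightarrow> (\<Prod>W\<in>snd p. f (card W)) * (\<Prod>W\<in>\<tau>. f (card W)))"
      using disj fin by (simp add: glue_def prod.union_disjoint)
    have "partition_on ({..<n} - insert l V) (\<rho> \<union> \<tau>)"
    proof (rule partition_onI)
      have "\<Union>(\<rho> \<union> \<tau>) = ({..<l} - V) \<union> {Suc l..<n}"
        using partition_onD1[OF \<rho>] partition_onD1[OF \<tau>(1)] by simp
      also have "\<dots> = {..<n} - insert l V" using V l by fastforce
      finally show "\<Union>(\<rho> \<union> \<tau>) = {..<n} - insert l V" .
      show "disjnt p q" if "p \<in> \<rho> \<union> \<tau>" "q \<in> \<rho> \<union> \<tau>" "p \<noteq> q" for p q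
      proof -
        have "p \<inter> q = {}" if "p \<in> \<rho>" "q \<in> \<tau>" for p q
          using \<rho>sub[OF that(1)] \<tau>sub[OF that(2)] by fastforce
        then have "p \<inter> q = {}"
          using that disjointD[OF partition_onD2[OF \<rho>]] disjointD[OF partition_onD2[OF \<tau>(1)]]
          by (metis UnE Int_commute)
        then show ?thesis by (simp add: disjnt_def)
      qed
      show "{} \<notin> \<rho> \<union> \<tau>" using \<rho>sub \<tau>sub by blast
    qed
    moreover have "noncrossing (insert (insert l V) (\<rho> \<union> \<tau>))"
      unfolding noncrossing_def
    proof (intro ballI impI)
      fix X Y a b c d
      assume X: "X \<in> insert (insert l V) (\<rho> \<union> \<tau>)" and Y: "Y \<in> insert (insert l V) (\<rho> \<union> \<tau>)"
        and mem: "a \<in> X" "b \<in> Y" "c \<in> X" "d \<in> Y" and less: "a < b \<and> b < c \<and> c < d"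
      have nc': "P = Q" if "P \<in> insert V \<rho>" "Q \<in> insert V \<rho>" "a \<in> P" "b \<in> Q" "c \<in> P" "d \<in> Q"
        "a < b" "b < c" "c < d" for P Q a b c d
        using nc[unfolded noncrossing_def, rule_format, of P Q a b c d] that by simp
      have lower: "P \<subseteq> {..l}" if "P = insert l V \<or> P \<in> \<rho>" for P
        using that V \<rho>sub(1)[of P] by (auto dest!: subsetD)
      have X': "X = insert l V \<or> X \<in> \<rho> \<or> X \<in> \<tau>" and Y': "Y = insert l V \<or> Y \<in> \<rho> \<or> Y \<in> \<tau>"
        using X Y by simp_all
      consider "X \<in> \<tau>" "Y \<in> \<tau>" | "X \<in> \<tau>" "Y = insert l V \<or> Y \<in> \<rho>"
        | "X = insert l V \<or> X \<in> \<rho>" "Y \<in> \<tau>" | "X = insert l V" "Y = insert l V"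
        | "X = insert l V" "Y \<in> \<rho>" | "X \<in> \<rho>" "Y = insert l V" | "X \<in> \<rho>" "Y \<in> \<rho>"
        using X' Y' by metis
      then show "X = Y"
      proof cases
        case 1
        with \<tau>(2)[unfolded noncrossing_def, rule_format, of X Y a b c d] mem less
        show ?thesis by simp
      next
        case 2
        then have "a \<in> {Suc l..<n}" "b \<in> {..l}"
          using subsetD[OF \<tau>sub(1)] subsetD[OF lower] mem by blast+
        then show ?thesis using less by simp
      next
        case 3
        then have "b \<in> {Suc l..<n}" "c \<in> {..l}"
          using subsetD[OF \<tau>sub(1)] subsetD[OF lower] mem by blast+
        then show ?thesis using less by simp
      next
        case 5
        have "d < l" using 5 \<rho>sub(1) mem by blast
        then have "a \<in> V" "c \<in> V" using 5 mem less by auto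
        then have "V = Y" using nc'[of V Y a b c d] 5 mem less by blast
        then show ?thesis using \<rho>sub(3)[of Y] 5 mem \<open>a \<in> V\<close> by blast
      next
        case 6
        \<comment> \<open>The root can meet this pattern at its new point \<open>l\<close>; replacing \<open>l\<close> by \<open>0\<close> on the other side gives a crossing without it.\<close>
        have "c < l" using 6 \<rho>sub(1) mem by blast
        then have b: "b \<in> V" "0 \<in> V" using 6 mem less V0 by auto
        have "a \<notin> V" using \<rho>sub(3)[of X] 6 mem by blast
        then have "0 < a" using b by (cases a) auto
        then have "V = X" using nc'[of V X 0 a b c] 6 mem less b by blast
        then show ?thesis using \<rho>sub(3)[of X] 6 mem \<open>a \<notin> V\<close> by blast
      next
        case 7
        then show ?thesis using nc'[of X Y a b c d] mem less by blast
      qed simp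
    qed
    moreover have "card (insert l V) = Suc s" using lV finV s by simp
    moreover have "0 \<in> insert l V" using V0 by (cases l) auto
    ultimately show "glue x \<in> rooted_NC n (Suc s)"
      using V l unfolding rooted_NC_def by (simp add: glue_def) fastforce
  next
    fix y assume "y \<in> rooted_NC n (Suc s)"
    then obtain V \<rho> where y[simp]: "y = (V, \<rho>)" and V: "V \<subseteq> {..<n}"
      and \<rho>: "partition_on ({..<n} - V) \<rho>" and nc: "noncrossing (insert V \<rho>)"
      and V0: "n > 0 \<longrightarrow> 0 \<in> V" and s: "card V = Suc s"
      by (auto simp: rooted_NC_def)
    have finV: "finite V" using V by (rule finite_subset) simp
    have neV: "V \<noteq> {}" using s by auto
    define l where "l = Max V"
    have lV: "l \<in> V" using finV neV by (simp add: l_def)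
    have Vl: "V \<subseteq> {..l}" using finV by (auto simp: l_def)
    have ln: "l < n" using lV V by auto
    have z: "0 \<in> V" using V0 ln by auto
    have \<rho>sub: "W \<subseteq> {..<n} - V" "W \<noteq> {}" if "W \<in> \<rho>" for W
      using \<rho> that by (auto simp: partition_on_def)
    have dich: "W \<subseteq> {..<l} \<or> W \<subseteq> {Suc l..<n}" if W: "W \<in> \<rho>" for W
    \<comment> \<open>Otherwise \<open>0 < c < l < a\<close> crosses the root.\<close>
    proof (rule ccontr)
      assume "\<not> ?thesis"
      then obtain a c where "a \<in> W" "a \<notin> {..<l}" "c \<in> W" "c \<notin> {Suc l..<n}" by blast
      then have ac: "a \<in> W" "\<not> a < l" "c \<in> W" "\<not> (Suc l \<le> c \<and> c < n)" by simp_all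
      have "a \<in> {..<n} - V" "c \<in> {..<n} - V" using subsetD[OF \<rho>sub(1)[OF W]] ac by blast+
      then have "a \<noteq> l" "c \<noteq> l" "c \<noteq> 0" "c < n" using lV z by (metis DiffD2, metis DiffD2, metis DiffD2, simp)
      then have "0 < c" "c < l" "l < a" using ac by auto
      then have "V = W" using nc W ac z lV unfolding noncrossing_def by blast
      then show False using \<rho>sub[OF W] by blast
    qed
    have join: "{W\<in>\<rho>. W \<subseteq> {..<l}} \<union> {W\<in>\<rho>. W \<subseteq> {Suc l..<n}} = \<rho>"
      using dich by blast
    show "glue (cut y) = y"
      using join lV unfolding y by (simp add: glue_def cut_def l_def[symmetric] insert_absorb)
    have un: "\<Union>\<rho> = {..<n} - V" using partition_onD1[OF \<rho>] by simp
    have dj: "disjnt p q" if "p \<in> \<rho>" "q \<in> \<rho>" "p \<noteq> q" for p q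
      using partition_onD2[OF \<rho>] that by (auto simp: disjoint_def disjnt_def)
    have "partition_on ({..<l} - (V - {l})) {W\<in>\<rho>. W \<subseteq> {..<l}}"
    proof (rule partition_onI)
      show "\<Union>{W\<in>\<rho>. W \<subseteq> {..<l}} = {..<l} - (V - {l})"
      proof (intro equalityI subsetI)
        fix i assume i: "i \<in> {..<l} - (V - {l})"
        then have "i \<in> {..<n} - V" using ln by auto
        then obtain W where W: "W \<in> \<rho>" "i \<in> W" using un by blast
        then have "W \<subseteq> {..<l}" using dich[of W] i by fastforce
        then show "i \<in> \<Union>{W\<in>\<rho>. W \<subseteq> {..<l}}" using W by blast
      qed (use \<rho>sub in blast)
    qed (use dj \<rho>sub in auto)
    moreover have "partition_on {Suc l..<n} {W\<in>\<rho>. W \<subseteq> {Suc l..<n}}"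
    proof (rule partition_onI)
      show "\<Union>{W\<in>\<rho>. W \<subseteq> {Suc l..<n}} = {Suc l..<n}"
      proof (intro equalityI subsetI)
        fix i assume i: "i \<in> {Suc l..<n}"
        then have "i \<in> {..<n} - V" using Vl by auto
        then obtain W where W: "W \<in> \<rho>" "i \<in> W" using un by blast
        then have "W \<subseteq> {Suc l..<n}" using dich[of W] i by fastforce
        then show "i \<in> \<Union>{W\<in>\<rho>. W \<subseteq> {Suc l..<n}}" using W by blast
      qed (use \<rho>sub in blast)
    qed (use dj \<rho>sub in auto)
    moreover have "noncrossing {W\<in>\<rho>. W \<subseteq> {Suc l..<n}}"
      using nc by (rule noncrossing_subset) auto
    moreover have "noncrossing (insert (V - {l}) {W\<in>\<rho>. W \<subseteq> {..<l}})"
    proof -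
      have fresh: "V \<notin> \<rho>" using \<rho>sub by blast
      \<comment> \<open>A crossing after the removal of \<open>l\<close> is a crossing before it; \<open>?up\<close> restores the original block.\<close>
      let ?up = "\<lambda>U. if U \<in> \<rho> then U else V"
      show ?thesis
        unfolding noncrossing_def
      proof (intro ballI impI)
        fix X Y a b c d
        assume X: "X \<in> insert (V - {l}) {W\<in>\<rho>. W \<subseteq> {..<l}}"
          and Y: "Y \<in> insert (V - {l}) {W\<in>\<rho>. W \<subseteq> {..<l}}"
          and mem: "a \<in> X" "b \<in> Y" "c \<in> X" "d \<in> Y" and less: "a < b \<and> b < c \<and> c < d"
        have "?up X = ?up Y"
          using nc[unfolded noncrossing_def, rule_format, of "?up X" "?up Y" a b c d] X Y mem less
          by (auto split: if_splits)
        then show "X = Y" using X Y fresh by (auto split: if_splits)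
      qed
    qed
    moreover have "card (V - {l}) = s" using s lV finV by simp
    moreover have "V - {l} \<subseteq> {..<l}" using Vl by fastforce
    ultimately show "cut y \<in> S"
      using ln z unfolding S_def rooted_NC_def NC_on_def y by (auto simp: cut_def l_def[symmetric])
  qed
  finally show ?thesis ..
qed

text \<open>
  The recursion is a convolution with \<open>fps_X * T\<close>, where \<open>T\<close> is the generating function of all
  non-crossing partitions; the factor \<open>fps_X\<close> accounts for the point \<open>l\<close> itself.
\<close>
lemma rooted_weight_power:
  "rooted_weight f n s = ((fps_X * Abs_fps (\<lambda>m. NC_weight f {..<m})) ^ s) $ n"
proof (induction s arbitrary: n)
  case 0
  then show ?case by (simp add: rooted_weight_0)
next
  case (Suc s)
  let ?T = "Abs_fps (\<lambda>m. NC_weight f {..<m})"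
  let ?Y = "fps_X * ?T"
  have "(?Y ^ Suc s) $ n = (?Y ^ s * ?Y) $ n" by (simp add: mult.commute)
  also have "\<dots> = (\<Sum>l=0..n. (?Y ^ s) $ l * ?Y $ (n - l))"
    by (simp add: fps_mult_nth)
  also have "\<dots> = (\<Sum>l<n. (?Y ^ s) $ l * ?Y $ (n - l))"
    by (rule sum.mono_neutral_right) auto
  also have "\<dots> = (\<Sum>l<n. rooted_weight f l s * NC_weight f {..<n - Suc l})"
    by (intro sum.cong refl) (auto simp: Suc.IH)
  finally show ?case by (simp add: rooted_weight_Suc)
qed

text \<open>
  The power series form of the moment-cumulant formula. The value \<open>f 0\<close> is not the weight of any block;
  setting it to \<open>1\<close> produces the constant term.
\<close>
theorem NC_weight_functional_equation:
  assumes "f 0 = 1"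
  defines "T \<equiv> Abs_fps (\<lambda>n. NC_weight f {..<n})"
  shows "T = Abs_fps f oo (fps_X * T)"
proof (rule fps_ext)
  fix n
  show "T $ n = (Abs_fps f oo (fps_X * T)) $ n"
  proof (cases "n = 0")
    case True
    have "NC_on {} = {{}}" by (auto simp: NC_on_def partition_on_empty noncrossing_def)
    then show ?thesis using True assms(1) by (simp add: T_def NC_weight_def)
  next
    case False
    then have "T $ n = (\<Sum>s\<le>n. f s * rooted_weight f n s)"
      by (simp add: T_def NC_weight_first_block)
    also have "\<dots> = (Abs_fps f oo (fps_X * T)) $ n"
      unfolding T_def rooted_weight_power fps_compose_nth by (simp add: atLeast0AtMost)
    finally show ?thesis .
  qed
qed

section \<open>Power series over a star algebra\<close>

interpretation complex_vec: vector_space "scaleC :: complex \<Rightarrow> 'a::complex_star_algebra \<Rightarrow> 'a"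
  by unfold_locales (simp_all add: scaleC_add_right scaleC_add_left scaleC_scaleC scaleC_one)

lemma gen_algebra_zero: "0 \<in> gen_algebra S"
  using gen_algebra.scaleC[OF gen_algebra.one, of 0 S] by simp

lemma gen_algebra_diff:
  assumes "x \<in> gen_algebra S" "y \<in> gen_algebra S"
  shows "x - y \<in> gen_algebra S"
  using gen_algebra.add[OF assms(1) gen_algebra.scaleC[OF assms(2), of "-1"]]
  by simp

lemma gen_algebra_sum:
  "(\<And>i. i \<in> I \<Longrightarrow> f i \<in> gen_algebra S) \<Longrightarrow> sum f I \<in> gen_algebra S"
  by (induction I rule: infinite_finite_induct) (auto intro: gen_algebra_zero gen_algebra.add)

lemma gen_algebra_subset:
  assumes "S \<subseteq> gen_algebra S'"
  shows "gen_algebra S \<subseteq> gen_algebra S'"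
proof
  fix x assume "x \<in> gen_algebra S"
  then show "x \<in> gen_algebra S'"
    by induction (use assms in \<open>auto intro: gen_algebra.intros\<close>)
qed

lemma gen_algebra_prod_list:
  "set xs \<subseteq> gen_algebra S \<Longrightarrow> prod_list xs \<in> gen_algebra S"
  by (induction xs) (auto intro: gen_algebra.one gen_algebra.mult)

context star_prob_space
begin

lemma phi_zero [simp]: "\<phi> 0 = 0"
  using scaleC[of 0 0] by simp

lemma phi_minus [simp]: "\<phi> (- x) = - \<phi> x"
  using scaleC[of "-1" x] by simp

lemma phi_diff: "\<phi> (x - y) = \<phi> x - \<phi> y"
  using add[of x "- y"] by simp

lemma phi_sum: "\<phi> (sum f I) = (\<Sum>i\<in>I. \<phi> (f i))"
  by (induction I rule: infinite_finite_induct) (simp_all add: add)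

end

text \<open>
  Scalar power series, viewed as central elements of the power series over the algebra.
\<close>
definition fps_lift :: "complex fps \<Rightarrow> 'a::complex_star_algebra fps" where
  "fps_lift f = Abs_fps (\<lambda>n. scaleC (f $ n) 1)"

lemma fps_lift_mult_nth: "(fps_lift f * F) $ n = (\<Sum>i=0..n. scaleC (f $ i) (F $ (n - i)))"
  by (simp add: fps_lift_def fps_mult_nth mult_scaleC_left)

lemma fps_lift_one [simp]: "fps_lift 1 = 1"
  by (rule fps_ext) (simp add: fps_lift_def)

lemma fps_lift_add: "fps_lift (f + g) = fps_lift f + fps_lift g"
  by (rule fps_ext) (simp add: fps_lift_def scaleC_add_left)

lemma fps_lift_diff: "fps_lift (f - g) = fps_lift f - fps_lift g"
  by (rule fps_ext) (simp add: fps_lift_def complex_vec.scale_left_diff_distrib)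

lemma fps_lift_mult: "fps_lift (f * g) = fps_lift f * fps_lift g"
  by (rule fps_ext)
    (simp add: fps_lift_mult_nth fps_lift_def fps_mult_nth complex_vec.scale_sum_left
        mult_scaleC_left scaleC_scaleC)

lemma fps_lift_commute: "F * fps_lift f = fps_lift f * F"
proof (rule fps_ext)
  fix n
  have "(F * fps_lift f) $ n = (\<Sum>i=0..n. scaleC (f $ (n - i)) (F $ i))"
    by (simp add: fps_lift_def fps_mult_nth mult_scaleC_right)
  also have "\<dots> = (\<Sum>i=0..n. scaleC (f $ i) (F $ (n - i)))"
    by (rule sum.reindex_bij_witness[of _ "\<lambda>i. n - i" "\<lambda>i. n - i"]) auto
  finally show "(F * fps_lift f) $ n = (fps_lift f * F) $ n"
    by (simp add: fps_lift_mult_nth)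
qed

text \<open>
  The geometric series \<open>\<Sum> W\<^sup>k\<close>, for \<open>W\<close> without constant term: the powers with \<open>k > n\<close> do
  not reach the \<open>n\<close>-th coefficient, so the truncated sum is exact.
\<close>
definition fps_geom :: "'b::ring_1 fps \<Rightarrow> 'b fps" where
  "fps_geom W = Abs_fps (\<lambda>n. (\<Sum>k\<le>n. W ^ k) $ n)"

lemma fps_power_nth_eq_0:
  fixes W :: "'b::ring_1 fps"
  assumes "W $ 0 = 0" "n < k"
  shows "(W ^ k) $ n = 0"
  using startsby_zero_power_prefix[OF assms(1)] assms(2) by blast

lemma fps_geom_nth:
  fixes W :: "'b::ring_1 fps"
  assumes "W $ 0 = 0" "n \<le> N"
  shows "fps_geom W $ n = (\<Sum>k\<le>N. W ^ k) $ n"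
proof -
  have "(\<Sum>k\<le>N. (W ^ k) $ n) = (\<Sum>k\<le>n. (W ^ k) $ n)"
    using assms by (intro sum.mono_neutral_right) (auto simp: fps_power_nth_eq_0)
  then show ?thesis by (simp add: fps_geom_def fps_sum_nth)
qed

text \<open>
  Coefficientwise the sum telescopes, because the truncation may be chosen uniformly for all
  coefficients up to \<open>n\<close>.
\<close>
lemma fps_geom_inverse:
  fixes W :: "'b::ring_1 fps"
  assumes "W $ 0 = 0"
  shows "(1 - W) * fps_geom W = 1" "fps_geom W * (1 - W) = 1"
proof -
  have tail: "(\<Sum>k\<le>n. W * W ^ k) $ n = (\<Sum>k\<le>n. W ^ k) $ n - 1 $ n" for n
  proof -
    have "(\<Sum>k\<le>Suc n. W ^ k) = 1 + (\<Sum>k\<le>n. W * W ^ k)"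
      by (simp add: sum.atMost_Suc_shift del: sum.atMost_Suc)
    moreover have "(\<Sum>k\<le>Suc n. W ^ k) $ n = (\<Sum>k\<le>n. W ^ k) $ n"
      by (simp add: fps_power_nth_eq_0[OF assms] del: power_Suc)
    ultimately show ?thesis using assms by (cases "n = 0") auto
  qed
  have "(W * fps_geom W) $ n = fps_geom W $ n - 1 $ n" for n
  proof -
    have "(W * fps_geom W) $ n = (W * (\<Sum>k\<le>n. W ^ k)) $ n"
      unfolding fps_mult_nth by (intro sum.cong refl) (simp add: fps_geom_nth[OF assms, of _ n])
    then show ?thesis
      using tail by (simp add: sum_distrib_left fps_geom_nth[OF assms, of n n])
  qed
  then have "W * fps_geom W = fps_geom W - 1" by (intro fps_ext) simp
  then show "(1 - W) * fps_geom W = 1" by (simp add: algebra_simps)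
  have "(fps_geom W * W) $ n = fps_geom W $ n - 1 $ n" for n
  proof -
    have "(fps_geom W * W) $ n = ((\<Sum>k\<le>n. W ^ k) * W) $ n"
      unfolding fps_mult_nth by (intro sum.cong refl) (simp add: fps_geom_nth[OF assms, of _ n])
    then show ?thesis
      using tail by (simp add: sum_distrib_right power_commutes fps_geom_nth[OF assms, of n n])
  qed
  then have "fps_geom W * W = fps_geom W - 1" by (intro fps_ext) simp
  then show "fps_geom W * (1 - W) = 1" by (simp add: algebra_simps)
qed

lemma fps_mult_nth_cong:
  assumes "\<And>i. i \<le> n \<Longrightarrow> F $ i = G $ i"
  shows "(A * F * B) $ n = (A * G * B) $ n"
proof -
  have "(A * F) $ i = (A * G) $ i" if "i \<le> n" for i
    unfolding fps_mult_nth using assms that by (intro sum.cong refl) simp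
  then show ?thesis
    unfolding fps_mult_nth[of _ B] by (intro sum.cong refl) simp
qed

definition coeffs_in :: "'b set \<Rightarrow> 'b fps \<Rightarrow> bool" where
  "coeffs_in A F \<longleftrightarrow> (\<forall>n. F $ n \<in> A)"

lemma coeffs_in_gen_algebra:
  shows coeffs_in_lift: "coeffs_in (gen_algebra S) (fps_lift f)"
    and coeffs_in_const: "x \<in> gen_algebra S \<Longrightarrow> coeffs_in (gen_algebra S) (fps_const x)"
    and coeffs_in_one: "coeffs_in (gen_algebra S) 1"
    and coeffs_in_diff: "coeffs_in (gen_algebra S) F \<Longrightarrow> coeffs_in (gen_algebra S) G \<Longrightarrow>
      coeffs_in (gen_algebra S) (F - G)"
    and coeffs_in_mult: "coeffs_in (gen_algebra S) F \<Longrightarrow> coeffs_in (gen_algebra S) G \<Longrightarrow>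
      coeffs_in (gen_algebra S) (F * G)"
  by (auto simp: coeffs_in_def fps_lift_def fps_mult_nth gen_algebra_zero
      intro!: gen_algebra_diff gen_algebra_sum gen_algebra.mult gen_algebra.scaleC gen_algebra.one)

lemma coeffs_in_power:
  "coeffs_in (gen_algebra S) F \<Longrightarrow> coeffs_in (gen_algebra S) (F ^ k)"
  by (induction k) (simp_all add: coeffs_in_one coeffs_in_mult)

lemma coeffs_in_geom:
  "coeffs_in (gen_algebra S) F \<Longrightarrow> coeffs_in (gen_algebra S) (fps_geom F)"
  using coeffs_in_power[of S F]
  by (auto simp: coeffs_in_def fps_geom_def fps_sum_nth intro!: gen_algebra_sum)

definition moment_fps :: "('a::complex_star_algebra \<Rightarrow> complex) \<Rightarrow> 'a \<Rightarrow> complex fps" where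
  "moment_fps \<phi> x = Abs_fps (\<lambda>n. \<phi> (x ^ n))"

definition cumulant_fps :: "('a::complex_star_algebra \<Rightarrow> complex) \<Rightarrow> 'a \<Rightarrow> complex fps" where
  "cumulant_fps \<phi> x = Abs_fps (\<lambda>n. if n = 0 then 1 else kappa \<phi> n x)"

definition expect_fps :: "('a::complex_star_algebra \<Rightarrow> complex) \<Rightarrow> 'a fps \<Rightarrow> complex fps" where
  "expect_fps \<phi> F = Abs_fps (\<lambda>n. \<phi> (F $ n))"

text \<open>
  The inverse of \<open>C - fps_X x\<close>, factored as \<open>C (1 - (fps_X / C) x)\<close> and expanded as a geometric
  series.
\<close>
definition resolvent_fps :: "complex fps \<Rightarrow> 'a::complex_star_algebra \<Rightarrow> 'a fps" where
  "resolvent_fps C x =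
     fps_lift (inverse C) * fps_geom (fps_lift (fps_X * inverse C) * fps_const x)"

lemma nths_replicate:
  assumes "V \<subseteq> {..<n}"
  shows "nths (replicate n x) V = replicate (card V) x"
proof -
  have "{i. i < n \<and> i \<in> V} = V" using assms by auto
  then have "length (nths (replicate n x) V) = card V" by (simp add: length_nths)
  moreover have "\<forall>y\<in>set (nths (replicate n x) V). y = x"
    using set_nths_subset[of "replicate n x" V] by auto
  ultimately show ?thesis by (metis replicate_length_same)
qed

context star_prob_space
begin

lemma moment_cumulant_fps:
  "moment_fps \<phi> x = cumulant_fps \<phi> x oo (fps_X * moment_fps \<phi> x)"
proof -
  let ?f = "\<lambda>n. if n = 0 then 1 else kappa \<phi> n x"
  have "\<phi> (x ^ n) = NC_weight ?f {..<n}" for n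
  proof (cases "n = 0")
    case True
    have "NC_on {} = {{}}" by (auto simp: NC_on_def partition_on_empty noncrossing_def)
    then show ?thesis using True unital by (simp add: NC_weight_def)
  next
    case False
    then have "\<phi> (x ^ n) = (\<Sum>\<pi> \<in> NC n. \<Prod>V\<in>\<pi>. free_cumulant \<phi> (nths (replicate n x) V))"
      using moment_cumulant[of "replicate n x" \<phi>] by (simp add: prod_list_replicate)
    also have "\<dots> = NC_weight ?f {..<n}"
      unfolding NC_weight_def NC_def NC_on_def
    proof (intro sum.cong prod.cong refl)
      fix \<pi> V assume "\<pi> \<in> {\<pi>. partition_on {..<n} \<pi> \<and> noncrossing \<pi>}" "V \<in> \<pi>"
      then have V: "V \<subseteq> {..<n}" "V \<noteq> {}" by (auto simp: partition_on_def)
      then have "card V \<noteq> 0" using finite_subset[OF V(1)] by simp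
      then show "free_cumulant \<phi> (nths (replicate n x) V) = ?f (card V)"
        using V(1) by (simp add: nths_replicate kappa_def)
    qed
    finally show ?thesis .
  qed
  then show ?thesis
    using NC_weight_functional_equation[of ?f]
    by (simp add: moment_fps_def cumulant_fps_def)
qed

text \<open>
  Put \<open>Y = fps_X T\<close> and \<open>Z = fps_X / C\<close> with \<open>T\<close> the moment series. Then \<open>T \<circ> Z = C\<close> says
  \<open>Y \<circ> Z = fps_X\<close>, so \<open>Z\<close> is the compositional inverse of \<open>Y\<close>, and such an inverse is unique. For
  the cumulant series, \<open>T = C \<circ> Y\<close> says \<open>Z \<circ> Y = fps_X\<close>, and a one-sided compositional inverse is
  two-sided.
\<close>
lemma cumulant_fps_iff:
  assumes C: "C $ 0 = 1"
  shows "moment_fps \<phi> x oo (fps_X * inverse C) = C \<longleftrightarrow> C = cumulant_fps \<phi> x"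
proof -
  define T where "T = moment_fps \<phi> x"
  define K where "K = cumulant_fps \<phi> x"
  define Y where "Y = fps_X * T"
  define Z where "Z D = fps_X * inverse D" for D :: "complex fps"
  have T0: "T $ 0 = 1" and K0: "K $ 0 = 1"
    by (simp_all add: T_def K_def moment_fps_def cumulant_fps_def unital)
  have Y: "Y $ 0 = 0" and Z: "Z D $ 0 = 0" for D
    by (simp_all add: Y_def Z_def)
  have KY: "K oo Y = T"
    using moment_cumulant_fps[of x] by (simp add: T_def K_def Y_def)
  have ZY: "Z K oo Y = fps_X"
  proof -
    have "Z K oo Y = Y * inverse T"
      using Y K0 KY by (simp add: Z_def fps_compose_mult_distrib fps_inverse_compose)
    also have "\<dots> = fps_X * (T * inverse T)" by (simp add: Y_def mult_ac)
    also have "T * inverse T = 1" using T0 inverse_mult_eq_1[of T] by (simp add: mult.commute)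
    finally show ?thesis by simp
  qed
  have Z1: "Z K $ 1 \<noteq> 0" using K0 by (simp add: Z_def)
  have YZ: "Y oo Z K = fps_X"
  proof -
    have "Y = (fps_inv (Z K) oo Z K) oo Y"
      using fps_inv[OF Z Z1] Y by simp
    also have "\<dots> = fps_inv (Z K)"
      using fps_compose_assoc[OF Y Z, of "fps_inv (Z K)" K] ZY by simp
    finally show ?thesis using fps_inv[OF Z Z1] by simp
  qed
  have comp: "Y oo Z D = Z D * (T oo Z D)" for D
    using Z by (simp add: Y_def fps_compose_mult_distrib)
  have inv: "inverse D * D = 1" if "D $ 0 = 1" for D :: "complex fps"
    using that by (intro inverse_mult_eq_1) simp
  have key: "T oo Z C = C \<longleftrightarrow> Y oo Z C = fps_X" if "C $ 0 = 1" for C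
  proof
    assume "T oo Z C = C"
    then have "Y oo Z C = Z C * C" by (simp only: comp)
    then have "Y oo Z C = fps_X * (inverse C * C)" by (simp only: Z_def mult.assoc)
    then show "Y oo Z C = fps_X" using inv[OF that] by simp
  next
    assume "Y oo Z C = fps_X"
    then have "Z C * (T oo Z C) = fps_X" by (simp only: comp)
    then have "fps_X * (inverse C * (T oo Z C)) = fps_X * 1"
      by (simp only: mult.assoc[symmetric] Z_def[symmetric] mult_1_right)
    then have "inverse C * (T oo Z C) = 1" by (metis mult_left_cancel fps_X_neq_zero)
    then have "C * (inverse C * (T oo Z C)) = C" by simp
    then show "T oo Z C = C" using inv[OF that] by (metis mult.assoc mult.commute mult_1)
  qed
  have "C = K" if "T oo Z C = C"
  proof -
    have "Z C = (Z K oo Y) oo Z C" using ZY Z by simp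
    also have "\<dots> = Z K oo (Y oo Z C)" using fps_compose_assoc[OF Z Y] by simp
    also have "\<dots> = Z K" using that key[OF C] by simp
    finally have "inverse C = inverse K" by (simp add: Z_def)
    then show ?thesis using inv[OF C] inv[OF K0] by (metis mult.left_commute mult.right_neutral)
  qed
  moreover have "T oo Z K = K" using YZ key[OF K0] by simp
  ultimately show ?thesis unfolding T_def[symmetric] K_def[symmetric] Z_def[symmetric] by metis
qed

lemma expect_fps_lift_mult: "expect_fps \<phi> (fps_lift f * F) = f * expect_fps \<phi> F"
  unfolding expect_fps_def
  by (rule fps_ext) (simp add: fps_lift_mult_nth fps_mult_nth[of f] phi_sum scaleC)

lemma expect_resolvent_fps:
  "expect_fps \<phi> (resolvent_fps C x) = inverse C * (moment_fps \<phi> x oo (fps_X * inverse C))"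
proof -
  define Z where "Z = fps_X * inverse C"
  have "(fps_lift Z * fps_const x) ^ k = fps_lift (Z ^ k) * fps_const (x ^ k)" for k
  proof (induction k)
    case (Suc k)
    have "(fps_lift Z * fps_const x) ^ Suc k
        = fps_lift Z * (fps_const x * fps_lift (Z ^ k)) * fps_const (x ^ k)"
      by (simp add: Suc mult.assoc)
    also have "\<dots> = fps_lift (Z ^ Suc k) * fps_const (x ^ Suc k)"
      unfolding fps_lift_commute[of "fps_const x"]
      by (simp add: fps_lift_mult mult.assoc flip: fps_const_mult)
    finally show ?case .
  qed simp
  then have "expect_fps \<phi> (fps_geom (fps_lift Z * fps_const x)) = moment_fps \<phi> x oo Z"
    by (intro fps_ext)
      (simp add: expect_fps_def fps_geom_def fps_sum_nth phi_sum fps_compose_nth moment_fps_def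
        fps_lift_def mult_scaleC_left scaleC atLeast0AtMost mult.commute)
  then show ?thesis by (simp add: resolvent_fps_def expect_fps_lift_mult Z_def)
qed

text \<open>
  This characterizes the cumulants of \<open>x\<close> by an identity in the algebra that makes no reference to
  partitions, which is what makes sums of free elements accessible.
\<close>
lemma expect_resolvent_fps_eq_1_iff:
  assumes "C $ 0 = 1"
  shows "expect_fps \<phi> (resolvent_fps C x) = 1 \<longleftrightarrow> C = cumulant_fps \<phi> x"
proof -
  have inv: "inverse C * C = 1" "C * inverse C = 1"
    using assms inverse_mult_eq_1[of C] by (simp_all add: mult.commute)
  have "inverse C * D = 1 \<longleftrightarrow> D = C" for D
    using inv by (metis mult.assoc mult_1 mult.right_neutral)
  then show ?thesis
    using cumulant_fps_iff[OF assms] by (simp add: expect_resolvent_fps)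
qed

end

lemma resolvent_fps_inverse:
  fixes x :: "'a::complex_star_algebra"
  assumes "C $ 0 = 1"
  shows "(fps_lift C - fps_lift fps_X * fps_const x) * resolvent_fps C x = 1"
    and "resolvent_fps C x * (fps_lift C - fps_lift fps_X * fps_const x) = 1"
proof -
  define W :: "'a fps" where "W = fps_lift (fps_X * inverse C) * fps_const x"
  have W0: "W $ 0 = 0" by (simp add: W_def fps_lift_def)
  have inv: "fps_lift C * fps_lift (inverse C) = (1 :: 'a fps)"
    "fps_lift (inverse C) * fps_lift C = (1 :: 'a fps)"
    using assms inverse_mult_eq_1[of C] by (simp_all add: mult.commute flip: fps_lift_mult)
  have "fps_lift C * W = fps_lift (C * (fps_X * inverse C)) * fps_const x"
    by (simp add: W_def fps_lift_mult mult.assoc)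
  also have "C * (fps_X * inverse C) = fps_X"
    using assms inverse_mult_eq_1[of C] by (simp add: mult_ac)
  finally have A: "fps_lift C - fps_lift fps_X * fps_const x = fps_lift C * (1 - W)"
    by (simp add: algebra_simps)
  have R: "resolvent_fps C x = fps_lift (inverse C) * fps_geom W"
    by (simp add: resolvent_fps_def W_def)
  have "(fps_lift C - fps_lift fps_X * fps_const x) * resolvent_fps C x
      = fps_lift C * ((1 - W) * fps_lift (inverse C)) * fps_geom W"
    unfolding A R by (simp only: mult.assoc)
  also have "\<dots> = fps_lift C * fps_lift (inverse C) * ((1 - W) * fps_geom W)"
    by (simp only: fps_lift_commute[of "1 - W"] mult.assoc)
  finally show "(fps_lift C - fps_lift fps_X * fps_const x) * resolvent_fps C x = 1"
    by (simp add: inv fps_geom_inverse[OF W0])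
  have "resolvent_fps C x * (fps_lift C - fps_lift fps_X * fps_const x)
      = fps_lift (inverse C) * (fps_geom W * fps_lift C) * (1 - W)"
    unfolding A R by (simp only: mult.assoc)
  also have "\<dots> = fps_lift (inverse C) * fps_lift C * (fps_geom W * (1 - W))"
    by (simp only: fps_lift_commute[of "fps_geom W"] mult.assoc)
  finally show "resolvent_fps C x * (fps_lift C - fps_lift fps_X * fps_const x) = 1"
    by (simp add: inv fps_geom_inverse[OF W0])
qed

text \<open>
  Alternating words in centered elements, with each letter tagged by the algebra from which it is taken.
  Lists are better suited to inductions on words than functions on initial segments of \<open>nat\<close>.
\<close>
definition centered_words ::
  "('a::complex_star_algebra \<Rightarrow> complex) \<Rightarrow> 'i set \<Rightarrow> ('i \<Rightarrow> 'a set) \<Rightarrow> ('i \<times> 'a) list set" where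
  "centered_words \<phi> I B =
     {zs. (\<forall>(i, x)\<in>set zs. i \<in> I \<and> x \<in> B i \<and> \<phi> x = 0) \<and> distinct_adj (map fst zs)}"

lemma free_subalgebras_iff_words:
  "free_subalgebras \<phi> I B \<longleftrightarrow>
     (\<forall>zs\<in>centered_words \<phi> I B. zs \<noteq> [] \<longrightarrow> \<phi> (prod_list (map snd zs)) = 0)"
proof
  assume free: "free_subalgebras \<phi> I B"
  show "\<forall>zs\<in>centered_words \<phi> I B. zs \<noteq> [] \<longrightarrow> \<phi> (prod_list (map snd zs)) = 0"
  proof (intro ballI impI)
    fix zs assume zs: "zs \<in> centered_words \<phi> I B" "zs \<noteq> []"
    have "fst (zs ! j) \<in> I \<and> snd (zs ! j) \<in> B (fst (zs ! j)) \<and> \<phi> (snd (zs ! j)) = 0"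
      if "j < length zs" for j
      using zs nth_mem[OF that] by (auto simp: centered_words_def split_beta)
    moreover have "fst (zs ! j) \<noteq> fst (zs ! Suc j)" if "Suc j < length zs" for j
      using zs that by (auto simp: centered_words_def distinct_adj_conv_nth)
    ultimately have "\<phi> (prod_list (map (\<lambda>j. snd (zs ! j)) [0..<length zs])) = 0"
      using free[unfolded free_subalgebras_def, rule_format,
          of "length zs" "\<lambda>j. fst (zs ! j)" "\<lambda>j. snd (zs ! j)"] zs(2) by simp
    moreover have "map (\<lambda>j. snd (zs ! j)) [0..<length zs] = map snd zs"
      by (rule nth_equalityI) simp_all
    ultimately show "\<phi> (prod_list (map snd zs)) = 0" by simp
  qed
next
  assume words: "\<forall>zs\<in>centered_words \<phi> I B. zs \<noteq> [] \<longrightarrow> \<phi> (prod_list (map snd zs)) = 0"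
  show "free_subalgebras \<phi> I B"
    unfolding free_subalgebras_def
  proof (intro allI impI)
    fix n :: nat and i x
    assume *: "n > 0 \<and> (\<forall>j<n. i j \<in> I \<and> x j \<in> B (i j) \<and> \<phi> (x j) = 0) \<and>
      (\<forall>j. Suc j < n \<longrightarrow> i j \<noteq> i (Suc j))"
    let ?zs = "map (\<lambda>j. (i j, x j)) [0..<n]"
    have "?zs \<in> centered_words \<phi> I B"
      using * by (auto simp: centered_words_def distinct_adj_conv_nth)
    moreover have "?zs \<noteq> []" using * by simp
    ultimately have "\<phi> (prod_list (map snd ?zs)) = 0" using words by blast
    then show "\<phi> (prod_list (map x [0..<n])) = 0" by (simp add: comp_def)
  qed
qed

lemma centered_wordsD:
  assumes "free_subalgebras \<phi> I B" "zs \<in> centered_words \<phi> I B" "zs \<noteq> []"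
  shows "\<phi> (prod_list (map snd zs)) = 0"
  using assms by (simp add: free_subalgebras_iff_words)

context star_prob_space
begin

text \<open>
  A coefficient of a product of series is a sum of products of coefficients. The prefix \<open>p\<close> collects the
  coefficients chosen so far and carries the induction.
\<close>
lemma phi_fps_prod_list_eq_0:
  assumes "\<And>xs. list_all2 (\<lambda>x F. \<exists>m. x = F $ m) xs Fs \<Longrightarrow> \<phi> (p * prod_list xs) = 0"
  shows "\<phi> (p * prod_list Fs $ n) = 0"
  using assms
proof (induction Fs arbitrary: p n)
  case Nil
  then show ?case using Nil[of "[]"] by simp
next
  case (Cons F Fs)
  have "\<phi> (p * F $ i * prod_list Fs $ (n - i)) = 0" for i
  proof (rule Cons.IH)
    fix xs assume "list_all2 (\<lambda>x F. \<exists>m. x = F $ m) xs Fs"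
    then show "\<phi> (p * F $ i * prod_list xs) = 0"
      using Cons.prems[of "F $ i # xs"] by (auto simp: mult.assoc)
  qed
  then show ?case
    by (simp add: fps_mult_nth sum_distrib_left phi_sum mult.assoc)
qed

lemma free_fps_word_eq_0:
  assumes free: "free_subalgebras \<phi> I B"
    and E: "\<And>i n. i \<in> I \<Longrightarrow> E i $ n \<in> B i" "\<And>i n. i \<in> I \<Longrightarrow> \<phi> (E i $ n) = 0"
    and w: "w \<noteq> []" "set w \<subseteq> I" "distinct_adj w"
  shows "\<phi> (prod_list (map E w) $ n) = 0"
proof -
  have "\<phi> (1 * prod_list (map E w) $ n) = 0"
  proof (rule phi_fps_prod_list_eq_0)
    fix xs assume xs: "list_all2 (\<lambda>x F. \<exists>m. x = F $ m) xs (map E w)"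
    then have len: "length xs = length w" by (auto dest: list_all2_lengthD)
    have "zip w xs \<in> centered_words \<phi> I B"
      using xs len w E unfolding centered_words_def
      by (force simp: list_all2_conv_all_nth set_zip subset_iff)
    moreover have "zip w xs \<noteq> []" using w len by (cases w; cases xs) auto
    ultimately have "\<phi> (prod_list (map snd (zip w xs))) = 0" by (rule centered_wordsD[OF free])
    then show "\<phi> (1 * prod_list xs) = 0" using len by simp
  qed
  then show ?thesis by simp
qed

text \<open>
  The argument runs as for the R-transform, with the resolvents as formal power series: \<open>A b\<close> is
  \<open>C - fps_X x\<close> for the two variables, \<open>R b\<close> its inverse, and \<open>E b = 1 - R b\<close> has centered
  coefficients in the algebra of one variable. The factorization
  \<open>A\<^sub>u + A\<^sub>v - 1 = A\<^sub>u (1 - E\<^sub>u E\<^sub>v) A\<^sub>v\<close> expresses the resolvent of \<open>u + v\<close> through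
  alternating products.
\<close>
lemma cumulant_fps_add_free:
  assumes free: "free_subalgebras \<phi> UNIV (\<lambda>b. gen_algebra (if b then {v} else {u}))"
  shows "cumulant_fps \<phi> (u + v) = cumulant_fps \<phi> u + cumulant_fps \<phi> v - 1"
proof -
  define x where "x b = (if b then v else u)" for b
  define C where "C b = cumulant_fps \<phi> (x b)" for b
  define R where "R b = resolvent_fps (C b) (x b)" for b
  define A where "A b = fps_lift (C b) - fps_lift fps_X * fps_const (x b)" for b
  define E where "E b = 1 - R b" for b
  have C0: "C b $ 0 = 1" for b by (simp add: C_def cumulant_fps_def)
  have AR: "A b * R b = 1" and RA: "R b * A b = 1" for b
    using resolvent_fps_inverse[OF C0] by (simp_all add: A_def R_def)
  have "expect_fps \<phi> (R b) = 1" for b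
    using expect_resolvent_fps_eq_1_iff[OF C0, of b "x b"] by (simp add: R_def C_def)
  then have "\<phi> (R b $ n) = 1 $ n" for b n
    by (metis expect_fps_def fps_nth_Abs_fps)
  then have E_centered: "\<phi> (E b $ n) = 0" for b n
    using unital by (simp add: E_def phi_diff)
  have "coeffs_in (gen_algebra {x b}) (E b)" for b
    unfolding E_def R_def resolvent_fps_def
    by (intro coeffs_in_gen_algebra coeffs_in_geom gen_algebra.base) simp
  moreover have "{x b} = (if b then {v} else {u})" for b by (simp add: x_def)
  ultimately have E_in: "E b $ n \<in> gen_algebra (if b then {v} else {u})" for b n
    by (metis coeffs_in_def)
  have E0: "E b $ 0 = 0" for b
  proof -
    have "R b $ 0 * A b $ 0 = 1" using RA[of b] by (metis fps_mult_nth_0 fps_one_nth)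
    moreover have "A b $ 0 = 1" by (simp add: A_def fps_lift_mult_nth C0) (simp add: fps_lift_def C0 scaleC_one)
    ultimately show ?thesis by (simp add: E_def)
  qed
  define W where "W = E False * E True"
  have W0: "W $ 0 = 0" by (simp add: W_def E0)
  have word: "\<phi> (prod_list (map E w) $ n) = 0" if "w \<noteq> []" "distinct_adj w" for w n
    using free_fps_word_eq_0[OF free E_in E_centered that(1) _ that(2)] by simp
  \<comment> \<open>The index word of \<open>W ^ k\<close>; with the letters of \<open>1 - E True\<close> and \<open>1 - E False\<close> attached, it still alternates.\<close>
  define w where "w k = concat (replicate k [False, True])" for k
  have Wk: "W ^ k = prod_list (map E (w k))" for k
    by (induction k) (simp_all add: w_def W_def mult.assoc)
  have "distinct_adj (True # w k @ [False])" for k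
    by (induction k) (simp_all add: w_def)
  then have alt: "distinct_adj (True # w k @ [False])" "distinct_adj (w k @ [False])"
    "distinct_adj (True # w k)" "distinct_adj (w k)" for k
    by (metis append_Cons distinct_adj_ConsD distinct_adj_appendD1)+
  define N where "N = R True * fps_geom W * R False"
  have "expect_fps \<phi> N = 1"
  proof (rule fps_ext)
    fix n
    have "N $ n = ((1 - E True) * (\<Sum>k\<le>n. W ^ k) * (1 - E False)) $ n"
      unfolding N_def E_def diff_diff_eq2
      by (subst fps_mult_nth_cong[where G = "\<Sum>k\<le>n. W ^ k"]) (simp_all add: fps_geom_nth[OF W0])
    also have "(1 - E True) * (\<Sum>k\<le>n. W ^ k) * (1 - E False)
        = (\<Sum>k\<le>n. W ^ k - E True * W ^ k - W ^ k * E False + E True * W ^ k * E False)"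
      by (simp add: algebra_simps sum_distrib_left sum_distrib_right sum.distrib sum_subtractf)
    also have "\<phi> (\<dots> $ n) = (\<Sum>k\<le>n. \<phi> (W ^ k $ n))"
    proof -
      have "\<phi> ((E True * W ^ k) $ n) = 0" "\<phi> ((W ^ k * E False) $ n) = 0"
        "\<phi> ((E True * W ^ k * E False) $ n) = 0" for k
        using word[OF _ alt(3), of k n] word[OF _ alt(2), of k n] word[OF _ alt(1), of k n]
        by (simp_all add: Wk mult.assoc)
      then show ?thesis by (simp add: fps_sum_nth phi_sum phi_diff add)
    qed
    also have "\<dots> = (\<Sum>k\<le>n. if k = 0 then 1 $ n else 0)"
    proof (intro sum.cong refl)
      fix k
      show "\<phi> (W ^ k $ n) = (if k = 0 then 1 $ n else 0)"
      proof (cases "k = 0")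
        case False
        then have "w k \<noteq> []" by (cases k) (simp_all add: w_def)
        then show ?thesis using word[OF _ alt(4)] False by (simp add: Wk)
      qed (simp add: unital)
    qed
    finally show "expect_fps \<phi> N $ n = 1 $ n" by (simp add: expect_fps_def)
  qed
  moreover have "N = resolvent_fps (C False + C True - 1) (u + v)"
  proof -
    let ?A = "fps_lift (C False + C True - 1) - fps_lift fps_X * fps_const (u + v)"
    let ?R = "resolvent_fps (C False + C True - 1) (u + v)"
    have "fps_lift fps_X * fps_const (u + v) = fps_lift fps_X * fps_const u + fps_lift fps_X * fps_const v"
      by (simp add: distrib_left flip: fps_const_add)
    then have "?A = A False + A True - 1"
      by (simp add: A_def x_def fps_lift_add fps_lift_diff)
    also have "\<dots> = A False * (1 - W) * A True"
    proof -
      \<comment> \<open>Since \<open>A * E = A - 1\<close> and \<open>E * A = A - 1\<close>, the mixed term is \<open>(A False - 1) * (A True - 1)\<close>.\<close>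
      have "A False * E False = A False - 1" "E True * A True = A True - 1"
        using AR RA by (simp_all add: E_def algebra_simps)
      then have "A False * W * A True = (A False - 1) * (A True - 1)"
        unfolding W_def by (metis mult.assoc)
      then show ?thesis by (simp add: algebra_simps)
    qed
    also have "\<dots> * N = A False * ((1 - W) * (A True * R True) * fps_geom W) * R False"
      unfolding N_def by (simp only: mult.assoc)
    finally have AN: "?A * N = 1" by (simp add: AR fps_geom_inverse[OF W0])
    have "?R * ?A = 1" by (rule resolvent_fps_inverse) (simp add: C0)
    then have "N = ?R * ?A * N" by (simp only: mult_1_left)
    also have "\<dots> = ?R * (?A * N)" by (rule mult.assoc)
    finally show ?thesis by (simp only: AN mult_1_right)
  qed
  ultimately have "C False + C True - 1 = cumulant_fps \<phi> (u + v)"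
    using expect_resolvent_fps_eq_1_iff[of "C False + C True - 1" "u + v"] by (simp add: C0)
  then show ?thesis by (simp add: C_def x_def)
qed

theorem kappa_add_free:
  assumes "free_subalgebras \<phi> UNIV (\<lambda>b. gen_algebra (if b then {v} else {u}))" "n \<ge> 1"
  shows "kappa \<phi> n (u + v) = kappa \<phi> n u + kappa \<phi> n v"
  using arg_cong[OF cumulant_fps_add_free[OF assms(1)], of "\<lambda>F. F $ n"] assms(2)
  by (simp add: cumulant_fps_def)

end

section \<open>Associativity of free independence\<close>

lemma centered_words_Nil [simp]: "[] \<in> centered_words \<phi> I B"
  by (simp add: centered_words_def)

lemma centered_words_Cons:
  "(i, x) # zs \<in> centered_words \<phi> I B \<longleftrightarrow>
     i \<in> I \<and> x \<in> B i \<and> \<phi> x = 0 \<and> zs \<in> centered_words \<phi> I B \<and> (zs = [] \<or> i \<noteq> fst (hd zs))"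
  by (cases zs) (auto simp: centered_words_def)

lemma centered_words_append:
  "us @ vs \<in> centered_words \<phi> I B \<longleftrightarrow>
     us \<in> centered_words \<phi> I B \<and> vs \<in> centered_words \<phi> I B \<and>
     (us = [] \<or> vs = [] \<or> fst (last us) \<noteq> fst (hd vs))"
  by (auto simp: centered_words_def distinct_adj_append_iff last_map hd_map)

lemma centered_words_map:
  assumes "inj_on f I" "f ` I \<subseteq> J" "\<And>i. i \<in> I \<Longrightarrow> B i \<subseteq> B' (f i)"
    and "zs \<in> centered_words \<phi> I B"
  shows "map (\<lambda>(i, x). (f i, x)) zs \<in> centered_words \<phi> J B'"
proof -
  have "inj_on f (set (map fst zs))"
    using assms(4) by (intro inj_on_subset[OF assms(1)]) (auto simp: centered_words_def)
  then have "distinct_adj (map f (map fst zs))"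
    by (rule distinct_adj_mapI[rotated]) (use assms(4) in \<open>simp add: centered_words_def\<close>)
  moreover have "map fst (map (\<lambda>(i, x). (f i, x)) zs) = map f (map fst zs)"
    by (simp add: comp_def split_beta)
  ultimately show ?thesis
    using assms unfolding centered_words_def by (simp del: map_map) fastforce
qed

text \<open>
  Renaming indices injectively keeps neighbouring letters distinct, and shrinking the algebras keeps
  their letters available.
\<close>
lemma free_subalgebras_reindex:
  assumes "free_subalgebras \<phi> J B'"
    and "inj_on f I" "f ` I \<subseteq> J" "\<And>i. i \<in> I \<Longrightarrow> B i \<subseteq> B' (f i)"
  shows "free_subalgebras \<phi> I B"
  unfolding free_subalgebras_iff_words
proof (intro ballI impI)
  fix zs assume zs: "zs \<in> centered_words \<phi> I B" "zs \<noteq> []"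
  then have "\<phi> (prod_list (map snd (map (\<lambda>(i, x). (f i, x)) zs))) = 0"
    using assms(2-4)
    by (intro centered_wordsD[OF assms(1)] centered_words_map[where f = f and I = I and B = B]) auto
  then show "\<phi> (prod_list (map snd zs)) = 0" by (simp add: comp_def split_beta)
qed

text \<open>
  Within a word over \<open>J \<times> I\<close>, multiply together each maximal run of letters with the same \<open>j\<close>. By
  inner freeness the product of a run is centered, and it lies in the \<open>j\<close>-th outer algebra, so the
  runs form an alternating centered word for the outer family.
\<close>
lemma free_subalgebras_join:
  assumes outer: "free_subalgebras \<phi> J (\<lambda>j. gen_algebra (S j))"
    and inner: "\<And>j. j \<in> J \<Longrightarrow> free_subalgebras \<phi> I (B j)"
    and sub: "\<And>i j. j \<in> J \<Longrightarrow> i \<in> I \<Longrightarrow> B j i \<subseteq> gen_algebra (S j)"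
  shows "free_subalgebras \<phi> (J \<times> I) (\<lambda>(j, i). B j i)"
proof -
  let ?outer = "centered_words \<phi> J (\<lambda>j. gen_algebra (S j))"
  let ?fine = "centered_words \<phi> (J \<times> I) (\<lambda>(j, i). B j i)"
  let ?p = "\<lambda>zs. prod_list (map snd zs)"
  have close: "ws @ [(j, ?p blk)] \<in> ?outer"
    if "ws \<in> ?outer" "blk \<in> centered_words \<phi> I (B j)" "blk \<noteq> []" "j \<in> J"
      "ws = [] \<or> fst (last ws) \<noteq> j" for ws blk j
  proof -
    have "set (map snd blk) \<subseteq> gen_algebra (S j)"
      using that(2) sub[OF that(4)] by (fastforce simp: centered_words_def)
    then have "?p blk \<in> gen_algebra (S j)" by (rule gen_algebra_prod_list)
    moreover have "\<phi> (?p blk) = 0" using centered_wordsD[OF inner[OF that(4)] that(2,3)] .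
    ultimately show ?thesis
      using that by (simp add: centered_words_append centered_words_Cons)
  qed
  have *: "\<phi> (?p ws * ?p blk * ?p zs) = 0"
    if "ws \<in> ?outer" "blk \<in> centered_words \<phi> I (B j)" "blk \<noteq> []" "j \<in> J"
      "ws = [] \<or> fst (last ws) \<noteq> j" "zs \<in> ?fine" "zs = [] \<or> fst (hd zs) \<noteq> (j, fst (last blk))"
    for ws :: "('b \<times> 'a) list" and blk :: "('c \<times> 'a) list" and j zs
    using that
  proof (induction zs arbitrary: ws blk j)
    case (Nil ws blk j)
    have "ws @ [(j, ?p blk)] \<in> ?outer"
      using Nil.prems by (intro close)
    then have "\<phi> (?p (ws @ [(j, ?p blk)])) = 0" by (rule centered_wordsD[OF outer]) simp
    then show ?case by simp
  next
    case (Cons z zs ws blk j)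
    obtain j' i' x where z: "z = ((j', i'), x)" by (metis surj_pair)
    have x: "j' \<in> J" "i' \<in> I" "x \<in> B j' i'" "\<phi> x = 0" "zs \<in> ?fine"
      "zs = [] \<or> (j', i') \<noteq> fst (hd zs)"
      using Cons.prems(6) by (auto simp: z centered_words_Cons)
    show ?case
    proof (cases "j' = j")
      case True
      then have "blk @ [(i', x)] \<in> centered_words \<phi> I (B j)"
        using Cons.prems x by (auto simp: z centered_words_append centered_words_Cons)
      then have "\<phi> (?p ws * ?p (blk @ [(i', x)]) * ?p zs) = 0"
        using Cons.prems x True by (intro Cons.IH) auto
      then show ?thesis by (simp add: z mult.assoc)
    next
      case False
      have "ws @ [(j, ?p blk)] \<in> ?outer"
        using Cons.prems by (intro close)
      moreover have "[(i', x)] \<in> centered_words \<phi> I (B j')"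
        using x by (simp add: centered_words_Cons)
      ultimately have "\<phi> (?p (ws @ [(j, ?p blk)]) * ?p [(i', x)] * ?p zs) = 0"
        using x False by (intro Cons.IH) auto
      then show ?thesis by (simp add: z mult.assoc)
    qed
  qed
  show ?thesis
    unfolding free_subalgebras_iff_words
  proof (intro ballI impI)
    fix zs assume zs: "zs \<in> ?fine" "zs \<noteq> []"
    then obtain j i x zs' where z: "zs = ((j, i), x) # zs'" by (metis list.exhaust surj_pair)
    then show "\<phi> (?p zs) = 0"
      using *[of "[]" "[(i, x)]" j zs'] zs by (auto simp: centered_words_Cons)
  qed
qed

context star_prob_space
begin

text \<open>
  Modulo scalars, the algebra generated by a family of subalgebras is spanned by non-empty alternating
  centered words. Multiplying a word from the left by an element \<open>b\<close> of one algebra gives a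
  combination of words: \<open>b\<close>, merged with the first letter if that comes from the same algebra, is
  split into its centered part and its mean. Hence the span of all words is a left module over the
  generated algebra, and it contains \<open>1\<close>.
\<close>
lemma gen_algebra_Union_span:
  fixes S :: "'j \<Rightarrow> 'a set" and J :: "'j set"
  defines "word \<equiv> \<lambda>zs :: ('j \<times> 'a) list. prod_list (map snd zs)"
    and "cw \<equiv> centered_words \<phi> J (\<lambda>j. gen_algebra (S j))"
  assumes d: "d \<in> gen_algebra (\<Union>j\<in>J. S j)"
  shows "\<exists>c. d - scaleC c 1 \<in> complex_vec.span (word ` (cw - {[]}))"
proof -
  let ?L = "complex_vec.span (word ` cw)"
  have center: "b - scaleC (\<phi> b) 1 \<in> gen_algebra (S j)" "\<phi> (b - scaleC (\<phi> b) 1) = 0"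
    if "b \<in> gen_algebra (S j)" for b j
    using that by (auto intro: gen_algebra_diff gen_algebra.intros simp: phi_diff scaleC unital)
  have left_word: "b * word w \<in> ?L" if b: "b \<in> gen_algebra (S j)" "j \<in> J" and w: "w \<in> cw" for b j w
  proof -
    have split: "y * word w' \<in> ?L"
      if y: "y \<in> gen_algebra (S j)" and w': "w' \<in> cw" "w' = [] \<or> j \<noteq> fst (hd w')" for y w'
    proof -
      have "(j, y - scaleC (\<phi> y) 1) # w' \<in> cw"
        using center[OF y] w' b(2) by (simp add: cw_def centered_words_Cons)
      then have "word ((j, y - scaleC (\<phi> y) 1) # w') + scaleC (\<phi> y) (word w') \<in> ?L"
        using w'(1) by (intro complex_vec.span_add complex_vec.span_scale complex_vec.span_base imageI)
      also have "word ((j, y - scaleC (\<phi> y) 1) # w') + scaleC (\<phi> y) (word w') = y * word w'"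
        by (simp add: word_def left_diff_distrib mult_scaleC_left)
      finally show ?thesis .
    qed
    show ?thesis
    proof (cases "w = [] \<or> j \<noteq> fst (hd w)")
      case True
      then show ?thesis using split b w by blast
    next
      case False
      then obtain x w' where ww: "w = (j, x) # w'" by (cases w) auto
      then have "x \<in> gen_algebra (S j)" "w' \<in> cw" "w' = [] \<or> j \<noteq> fst (hd w')"
        using w by (simp_all add: cw_def centered_words_Cons)
      then have "(b * x) * word w' \<in> ?L"
        using b by (intro split gen_algebra.mult)
      then show ?thesis by (simp add: ww word_def mult.assoc)
    qed
  qed
  have left: "b * l \<in> ?L" if "b \<in> gen_algebra (S j)" "j \<in> J" "l \<in> ?L" for b j l
    using that(3)
  proof (induction rule: complex_vec.span_induct)
    case (step x)
    then show ?case using left_word that by auto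
  next
    case base
    then show ?case
      by (auto simp: complex_vec.subspace_def distrib_left mult_scaleC_right
          intro: complex_vec.span_zero complex_vec.span_add complex_vec.span_scale)
  qed
  have "\<forall>l\<in>?L. d * l \<in> ?L"
    using d
  proof induction
    case (base x)
    then show ?case using left by (blast intro: gen_algebra.base)
  qed (auto simp: distrib_right mult_scaleC_left mult.assoc
      intro: complex_vec.span_add complex_vec.span_scale)
  moreover have "1 \<in> ?L"
    by (rule complex_vec.span_base, rule image_eqI[where x = "[]"]) (simp_all add: word_def cw_def)
  ultimately have "d \<in> ?L" by (metis mult.right_neutral)
  moreover have "?L \<subseteq> {d. \<exists>c. d - scaleC c 1 \<in> complex_vec.span (word ` (cw - {[]}))}" (is "_ \<subseteq> ?R")
  proof (rule complex_vec.span_minimal)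
    show "word ` cw \<subseteq> ?R"
    proof safe
      fix w assume w: "w \<in> cw"
      show "\<exists>c. word w - scaleC c 1 \<in> complex_vec.span (word ` (cw - {[]}))"
      proof (cases "w = []")
        case True
        then have "word w - scaleC 1 1 = 0" by (simp add: word_def scaleC_one)
        then show ?thesis using complex_vec.span_zero by metis
      next
        case False
        then have "word w - scaleC 0 1 \<in> complex_vec.span (word ` (cw - {[]}))"
          using w by (auto intro: complex_vec.span_base)
        then show ?thesis by blast
      qed
    qed
    show "complex_vec.subspace ?R"
      unfolding complex_vec.subspace_def
    proof (intro conjI ballI allI)
      have "0 - scaleC 0 1 \<in> complex_vec.span (word ` (cw - {[]}))"
        by (simp add: complex_vec.span_zero)
      then show "0 \<in> ?R" by blast
    next
      fix x y assume "x \<in> ?R" "y \<in> ?R"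
      then obtain c e where "x - scaleC c 1 \<in> complex_vec.span (word ` (cw - {[]}))"
        "y - scaleC e 1 \<in> complex_vec.span (word ` (cw - {[]}))" by blast
      then have "(x - scaleC c 1) + (y - scaleC e 1) \<in> complex_vec.span (word ` (cw - {[]}))"
        by (rule complex_vec.span_add)
      then have "(x + y) - scaleC (c + e) 1 \<in> complex_vec.span (word ` (cw - {[]}))"
        by (simp add: scaleC_add_left algebra_simps)
      then show "x + y \<in> ?R" by blast
    next
      fix c x assume "x \<in> ?R"
      then obtain e where "x - scaleC e 1 \<in> complex_vec.span (word ` (cw - {[]}))" by blast
      then have "scaleC c (x - scaleC e 1) \<in> complex_vec.span (word ` (cw - {[]}))"
        by (rule complex_vec.span_scale)
      then have "scaleC c x - scaleC (c * e) 1 \<in> complex_vec.span (word ` (cw - {[]}))"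
        by (simp add: complex_vec.scale_right_diff_distrib scaleC_scaleC)
      then show "scaleC c x \<in> ?R" by blast
    qed
  qed
  ultimately show ?thesis by blast
qed

text \<open>
  A centered element of the \<open>i\<close>-th group is a combination of non-empty centered words with letters from
  that group, since its scalar part is its expectation. Inserting such combinations into an alternating
  word over \<open>I\<close> gives words over \<open>J \<times> I\<close>; these alternate also at the seams, where the group
  changes.
\<close>
lemma free_subalgebras_group:
  fixes S :: "'j \<times> 'i \<Rightarrow> 'a set" and J :: "'j set" and I :: "'i set"
  assumes free: "free_subalgebras \<phi> (J \<times> I) (\<lambda>p. gen_algebra (S p))"
  shows "free_subalgebras \<phi> I (\<lambda>i. gen_algebra (\<Union>j\<in>J. S (j, i)))"
proof -
  define cw where "cw i = centered_words \<phi> J (\<lambda>j. gen_algebra (S (j, i)))" for i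
  define fw where "fw = centered_words \<phi> (J \<times> I) (\<lambda>p. gen_algebra (S p))"
  let ?p = "\<lambda>zs. prod_list (map snd zs)"
  define M where "M i = complex_vec.span (?p ` (cw i - {[]}))" for i
  define tag :: "'i \<Rightarrow> ('j \<times> 'a) list \<Rightarrow> (('j \<times> 'i) \<times> 'a) list"
    where "tag i = map (\<lambda>(j, x). ((j, i), x))" for i
  have tag: "tag i w \<in> fw" "?p (tag i w) = ?p w" "tag i w = [] \<longleftrightarrow> w = []"
    if "w \<in> cw i" "i \<in> I" for i w
  proof -
    show "tag i w \<in> fw"
      using that unfolding tag_def fw_def cw_def
      by (intro centered_words_map[where f = "\<lambda>j. (j, i)"]) (auto simp: inj_on_def)
  qed (simp_all add: tag_def comp_def split_beta)
  have phi_M: "\<phi> d = 0" if "d \<in> M i" "i \<in> I" for d i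
    using that(1) unfolding M_def
  proof (induction rule: complex_vec.span_induct)
    case (step d)
    then obtain w where w: "w \<in> cw i" "w \<noteq> []" "d = ?p w" by auto
    then have "\<phi> (?p (tag i w)) = 0"
      using tag[OF w(1) that(2)] by (intro centered_wordsD[OF free]) (simp_all add: fw_def)
    then show ?case using tag[OF w(1) that(2)] w by simp
  next
    case base
    then show ?case by (simp add: complex_vec.subspace_def add scaleC)
  qed
  have in_M: "d \<in> M i" if d: "d \<in> gen_algebra (\<Union>j\<in>J. S (j, i))" "\<phi> d = 0" and i: "i \<in> I" for d i
  proof -
    obtain c where c: "d - scaleC c 1 \<in> M i"
      using gen_algebra_Union_span[OF d(1)] unfolding M_def cw_def by blast
    then have "\<phi> (d - scaleC c 1) = 0" using phi_M i by blast
    then have "c = 0" using d(2) by (simp add: phi_diff scaleC unital)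
    then show ?thesis using c by simp
  qed
  have *: "\<phi> (?p acc * ?p zs) = 0"
    if "acc \<in> fw" "\<forall>(i, d)\<in>set zs. i \<in> I \<and> d \<in> M i" "distinct_adj (map fst zs)"
      "acc = [] \<or> zs = [] \<or> snd (fst (last acc)) \<noteq> fst (hd zs)" "acc \<noteq> [] \<or> zs \<noteq> []"
    for acc and zs :: "('i \<times> 'a) list"
    using that
  proof (induction zs arbitrary: acc)
    case (Nil acc)
    then have "\<phi> (?p acc) = 0" by (intro centered_wordsD[OF free]) (auto simp: fw_def)
    then show ?case by simp
  next
    case (Cons z zs acc)
    obtain i d where z: "z = (i, d)" by fastforce
    have i: "i \<in> I" and d: "d \<in> M i" using Cons.prems(2) by (auto simp: z)
    have "\<phi> (?p acc * d * ?p zs) = 0"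
      using d unfolding M_def
    proof (induction rule: complex_vec.span_induct)
      case (step d)
      then obtain w where w: "w \<in> cw i" "w \<noteq> []" "d = ?p w" by auto
      have ends: "fst (hd (tag i w)) = (fst (hd w), i)" "fst (last (tag i w)) = (fst (last w), i)"
        using w(2) by (simp_all add: tag_def hd_map last_map split_beta)
      have "acc @ tag i w \<in> fw"
        using Cons.prems(1,4) tag(1)[OF w(1) i] ends
        by (auto simp: fw_def centered_words_append z)
      then have "\<phi> (?p (acc @ tag i w) * ?p zs) = 0"
      proof (rule Cons.IH)
        show "distinct_adj (map fst zs)"
          using Cons.prems(3) by (auto simp: z dest: distinct_adj_ConsD)
        show "acc @ tag i w = [] \<or> zs = [] \<or> snd (fst (last (acc @ tag i w))) \<noteq> fst (hd zs)"
          using Cons.prems(3) ends tag(3)[OF w(1) i] w(2)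
          by (auto simp: z distinct_adj_Cons hd_map)
        show "acc @ tag i w \<noteq> [] \<or> zs \<noteq> []" using tag(3)[OF w(1) i] w(2) by simp
      qed (use Cons.prems(2) in auto)
      then show ?case using tag(2)[OF w(1) i] w(3) by simp
    next
      case base
      then show ?case
        by (simp add: complex_vec.subspace_def distrib_left distrib_right add scaleC
            mult_scaleC_left mult_scaleC_right)
    qed
    then show ?case by (simp add: z mult.assoc)
  qed
  show ?thesis
    unfolding free_subalgebras_iff_words
  proof (intro ballI impI)
    fix zs assume zs: "zs \<in> centered_words \<phi> I (\<lambda>i. gen_algebra (\<Union>j\<in>J. S (j, i)))" "zs \<noteq> []"
    then show "\<phi> (?p zs) = 0"
      using *[of "[]" zs] in_M by (fastforce simp: centered_words_def fw_def)
  qed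
qed

text \<open>
  The elements \<open>u i\<close> and \<open>v i\<close>, taken all together, are free by joining; grouping by \<open>i\<close> gives
  free algebras that contain the sums.
\<close>
lemma free_elements_add:
  assumes U: "free_elements \<phi> I u" and V: "free_elements \<phi> I v"
    and free: "free_subalgebras \<phi> UNIV (\<lambda>b::bool. gen_algebra (S b))"
    and u: "\<And>i. i \<in> I \<Longrightarrow> u i \<in> gen_algebra (S False)"
    and v: "\<And>i. i \<in> I \<Longrightarrow> v i \<in> gen_algebra (S True)"
  shows "free_elements \<phi> I (\<lambda>i. u i + v i)"
proof -
  define g where "g = (\<lambda>(b, i). if b then v i else u i)"
  have "free_subalgebras \<phi> (UNIV \<times> I) (\<lambda>(b, i). gen_algebra {g (b, i)})"
  proof (rule free_subalgebras_join[OF free])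
    show "free_subalgebras \<phi> I (\<lambda>i. gen_algebra {g (b, i)})" for b
      using U V by (cases b) (simp_all add: free_elements_def g_def)
    show "gen_algebra {g (b, i)} \<subseteq> gen_algebra (S b)" if "i \<in> I" for b i
      using u[OF that] v[OF that] by (intro gen_algebra_subset) (simp add: g_def split: bool.split)
  qed
  then have "free_subalgebras \<phi> (UNIV \<times> I) (\<lambda>p. gen_algebra {g p})" by (simp add: split_def)
  then have "free_subalgebras \<phi> I (\<lambda>i. gen_algebra (\<Union>b\<in>UNIV. {g (b, i)}))"
    by (rule free_subalgebras_group)
  then show ?thesis
    unfolding free_elements_def
  proof (rule free_subalgebras_reindex[where f = "\<lambda>i. i"])
    fix i
    have "u i + v i = g (False, i) + g (True, i)" by (simp add: g_def)
    also have "\<dots> \<in> gen_algebra (\<Union>b\<in>UNIV. {g (b, i)})"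
      by (intro gen_algebra.add gen_algebra.base) blast+
    finally show "gen_algebra {u i + v i} \<subseteq> gen_algebra (\<Union>b\<in>UNIV. {g (b, i)})"
      by (intro gen_algebra_subset) simp
  qed simp_all
qed

end

text \<open>
  An endpoint of one interval strictly inside another forces an overlap. If it is the right endpoint,
  then the overlap starts at the larger of the two left endpoints.
\<close>
lemma disjoint_half_open_endpoint:
  fixes s t :: "'i \<Rightarrow> real"
  assumes disj: "disjoint_family_on (\<lambda>i. {s i..<t i}) I" and less: "\<And>i. i \<in> I \<Longrightarrow> s i < t i"
    and i: "i \<in> I" "k \<in> I" and p: "p = s k \<or> p = t k"
  shows "\<not> (s i < p \<and> p < t i)"
proof
  assume *: "s i < p \<and> p < t i"
  define q where "q = (if p = s k then p else max (s i) (s k))"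
  have "q \<in> {s i..<t i} \<inter> {s k..<t k}"
    using * p less[OF i(1)] less[OF i(2)] by (auto simp: q_def)
  moreover have "k = i \<Longrightarrow> False" using * p by auto
  ultimately show False
    using disjoint_family_onD[OF disj i] by blast
qed

text \<open>
  After sorting all endpoints, each interval runs from one point of the subdivision to the next one, so
  its increment is among the consecutive increments of a single increasing sequence of times.
\<close>
lemma free_increments_disjoint:
  fixes X :: "real \<Rightarrow> 'a::complex_star_algebra"
  assumes incr: "\<And>n t. 0 \<le> t 0 \<Longrightarrow> (\<And>i. i < n \<Longrightarrow> t i < t (Suc i)) \<Longrightarrow>
      free_elements \<phi> {..<n} (\<lambda>i. X (t (Suc i)) - X (t i))"
    and st: "\<And>i. i \<in> I \<Longrightarrow> 0 \<le> s i \<and> s i < t i" and fin: "finite I"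
    and disj: "disjoint_family_on (\<lambda>i. {s i..<t i}) I"
  shows "free_elements \<phi> I (\<lambda>i. X (t i) - X (s i))"
proof (cases "I = {}")
  case True
  then show ?thesis by (auto simp: free_elements_def free_subalgebras_def)
next
  case False
  define P where "P = s ` I \<union> t ` I"
  define ps where "ps = sorted_list_of_set P"
  have finP: "finite P" using fin by (simp add: P_def)
  have ps: "set ps = P" "sorted_wrt (<) ps"
    using finP by (simp_all add: ps_def)
  have mono: "ps ! a < ps ! b" if "a < b" "b < length ps" for a b
    using sorted_wrt_nth_less[OF ps(2)] that by blast
  have index: "\<exists>a. Suc a < length ps \<and> ps ! a = s i \<and> ps ! Suc a = t i" if i: "i \<in> I" for i
  proof -
    have "s i \<in> set ps" "t i \<in> set ps" using i by (auto simp: ps P_def)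
    then obtain a b where ab: "a < length ps" "ps ! a = s i" "b < length ps" "ps ! b = t i"
      by (auto simp: in_set_conv_nth)
    have "a < b"
      using mono[of b a] ab st[OF i] by (cases a b rule: linorder_cases) auto
    moreover have "\<not> Suc a < b"
    proof
      assume "Suc a < b"
      then have "s i < ps ! Suc a" "ps ! Suc a < t i"
        using mono[of a "Suc a"] mono[of "Suc a" b] ab by auto
      moreover obtain k where "k \<in> I" "ps ! Suc a = s k \<or> ps ! Suc a = t k"
        using nth_mem[of "Suc a" ps] \<open>Suc a < b\<close> ab(3) by (auto simp: ps P_def)
      ultimately show False
        using disjoint_half_open_endpoint[OF disj _ i] st by blast
    qed
    ultimately have "b = Suc a" by simp
    then show ?thesis using ab by blast
  qed
  then obtain f where f: "\<And>i. i \<in> I \<Longrightarrow> Suc (f i) < length ps \<and> ps ! f i = s i \<and> ps ! Suc (f i) = t i"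
    by metis
  have "inj_on f I"
  proof (rule inj_onI, rule ccontr)
    fix i k assume ik: "i \<in> I" "k \<in> I" "f i = f k" "i \<noteq> k"
    then have "s i = s k" using f by metis
    then have "s i \<in> {s i..<t i} \<inter> {s k..<t k}" using st[OF ik(1)] st[OF ik(2)] by simp
    then show False using disjoint_family_onD[OF disj ik(1,2,4)] by blast
  qed
  moreover have "free_elements \<phi> {..<length ps - 1} (\<lambda>i. X (ps ! Suc i) - X (ps ! i))"
  proof (rule incr)
    obtain i where "i \<in> I" using False by blast
    then have "0 < length ps" using f by fastforce
    then have "ps ! 0 \<in> P" using ps nth_mem by blast
    then show "0 \<le> ps ! 0" using st by (force simp: P_def)
  qed (auto intro: mono)
  ultimately show ?thesis
    unfolding free_elements_def
  proof (elim free_subalgebras_reindex[rotated])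
    show "f ` I \<subseteq> {..<length ps - 1}" using f by fastforce
  qed (use f in auto)
qed

section \<open>The sum of two free Poisson processes\<close>

definition two_point_measure :: "real \<Rightarrow> real \<Rightarrow> real measure" where
  "two_point_measure x y = distr (measure_pmf (pmf_of_set (UNIV :: bool set))) borel (\<lambda>b. if b then y else x)"

lemma real_distribution_two_point_measure: "real_distribution (two_point_measure x y)"
proof -
  have "prob_space (two_point_measure x y)"
    unfolding two_point_measure_def by (rule measure_pmf.prob_space_distr) simp
  then show ?thesis
    by (simp add: real_distribution_def real_distribution_axioms_def two_point_measure_def)
qed

lemma compactly_supported_two_point_measure: "compactly_supported (two_point_measure x y)"
  unfolding compactly_supported_def
proof (intro exI conjI)
  show "AE z in two_point_measure x y. z \<in> {x, y}"
    unfolding two_point_measure_def by (subst AE_distr_iff) auto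
qed simp

lemma moment_two_point_measure: "(\<integral>z. z ^ n \<partial>two_point_measure x y) = (x ^ n + y ^ n) / 2"
proof -
  have "(\<integral>z. z ^ n \<partial>two_point_measure x y)
      = measure_pmf.expectation (pmf_of_set (UNIV :: bool set)) (\<lambda>b. (if b then y else x) ^ n)"
    unfolding two_point_measure_def by (subst integral_distr) simp_all
  also have "\<dots> = (x ^ n + y ^ n) / 2"
    by (subst integral_pmf_of_set) (simp_all add: UNIV_bool)
  finally show ?thesis .
qed

lemma adj_diff: "adj (x - y) = adj x - adj (y :: 'a::complex_star_algebra)"
proof -
  have "adj (x - y) + adj y = adj x" by (simp flip: adj_add)
  then show ?thesis by (simp add: eq_diff_eq)
qed

context star_prob_space
begin

text \<open>
  The rate and the jump size of a free Poisson process need not be determined by its law (for jump size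
  \<open>0\<close>, any rate will do), but the products \<open>k \<alpha>\<^sup>n\<close> are; they are read off at time \<open>1\<close>.
\<close>
lemma free_poisson_increment:
  assumes X: "free_poisson_process \<phi> X"
    and kappa: "\<And>t n. t \<ge> 0 \<Longrightarrow> n \<ge> 1 \<Longrightarrow> kappa \<phi> n (X t) = complex_of_real (t * \<beta> ^ n)"
    and "0 \<le> s" "s < t" "n \<ge> 1"
  shows "kappa \<phi> n (X t - X s) = complex_of_real ((t - s) * \<beta> ^ n)"
proof -
  obtain k \<alpha> where "free_poisson_process_with \<phi> k \<alpha> X"
    using X by (auto simp: free_poisson_process_def)
  then have X0: "X 0 = 0" and incr: "\<And>s t n. 0 \<le> s \<Longrightarrow> s < t \<Longrightarrow> n \<ge> 1 \<Longrightarrow>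
      kappa \<phi> n (X t - X s) = complex_of_real (real k * (t - s) * \<alpha> ^ n)"
    unfolding free_poisson_process_with_def by auto
  have "complex_of_real (real k * \<alpha> ^ n) = complex_of_real (\<beta> ^ n)"
    using incr[of 0 1 n] kappa[of 1 n] X0 \<open>n \<ge> 1\<close> by simp
  then have "real k * \<alpha> ^ n = \<beta> ^ n" by (simp only: of_real_eq_iff)
  then have "real k * (t - s) * \<alpha> ^ n = (t - s) * \<beta> ^ n" by (simp add: mult_ac)
  then show ?thesis using incr[OF assms(3-5)] by (simp only:)
qed

lemma compound_free_poisson_sum:
  assumes P1: "free_poisson_process \<phi> a1" and P2: "free_poisson_process \<phi> a2"
    and k1: "\<And>t n. t \<ge> 0 \<Longrightarrow> n \<ge> 1 \<Longrightarrow> kappa \<phi> n (a1 t) = complex_of_real (t * \<alpha>1 ^ n)"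
    and k2: "\<And>t n. t \<ge> 0 \<Longrightarrow> n \<ge> 1 \<Longrightarrow> kappa \<phi> n (a2 t) = complex_of_real (t * \<alpha>2 ^ n)"
    and free: "free_processes \<phi> a1 a2"
  shows "compound_free_poisson_family_with \<phi> (two_point_measure \<alpha>1 \<alpha>2) 2
    (\<lambda>s t. (a1 t + a2 t) - (a1 s + a2 s))"
proof -
  define S where "S b = (if b then a2 else a1) ` {0::real..}" for b
  have free': "free_subalgebras \<phi> UNIV (\<lambda>b. gen_algebra (S b))"
    using free by (simp add: free_processes_def S_def)
  have increment: "(a1 t + a2 t) - (a1 s + a2 s) = (a1 t - a1 s) + (a2 t - a2 s)" for s t
    by simp
  have in1: "a1 t - a1 s \<in> gen_algebra (S False)" and in2: "a2 t - a2 s \<in> gen_algebra (S True)"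
    if "0 \<le> s" "s < t" for s t
    by (rule gen_algebra_diff; rule gen_algebra.base; use that in \<open>simp add: S_def\<close>)+
  have free_incr: "free_elements \<phi> I (\<lambda>i. X (t i) - X (s i))"
    if "free_poisson_process \<phi> X" "finite I" "\<And>i. i \<in> I \<Longrightarrow> 0 \<le> s i \<and> s i < t i"
      "disjoint_family_on (\<lambda>i. {s i..<t i}) I"
    for X and I :: "nat set" and s t :: "nat \<Rightarrow> real"
  proof (rule free_increments_disjoint[OF _ that(3,2,4)])
    show "free_elements \<phi> {..<n} (\<lambda>i. X (t (Suc i)) - X (t i))"
      if "0 \<le> t 0" "\<And>i. i < n \<Longrightarrow> t i < t (Suc i)" for n t
      using \<open>free_poisson_process \<phi> X\<close> that
      by (auto simp: free_poisson_process_def free_poisson_process_with_def)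
  qed
  have sa: "adj (X t) = X t" if "free_poisson_process \<phi> X" "0 \<le> t" for X t
    using that by (auto simp: free_poisson_process_def free_poisson_process_with_def)
  show ?thesis
    unfolding compound_free_poisson_family_with_def increment
  proof (intro conjI allI impI)
    fix s t :: real assume st: "0 \<le> s \<and> s < t"
    then show "adj (a1 t - a1 s + (a2 t - a2 s)) = a1 t - a1 s + (a2 t - a2 s)"
      using sa[OF P1] sa[OF P2] by (simp add: adj_add adj_diff)
    fix n :: nat assume n: "n \<ge> 1"
    have "free_subalgebras \<phi> UNIV
        (\<lambda>b. gen_algebra (if b then {a2 t - a2 s} else {a1 t - a1 s}))"
      using in1[of s t] in2[of s t] st
      by (intro free_subalgebras_reindex[OF free', where f = "\<lambda>b. b"] gen_algebra_subset) auto
    then have "kappa \<phi> n (a1 t - a1 s + (a2 t - a2 s))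
        = kappa \<phi> n (a1 t - a1 s) + kappa \<phi> n (a2 t - a2 s)"
      using n by (rule kappa_add_free)
    also have "\<dots> = complex_of_real ((t - s) * \<alpha>1 ^ n + (t - s) * \<alpha>2 ^ n)"
      using st n
      by (simp add: free_poisson_increment[OF P1 k1] free_poisson_increment[OF P2 k2])
    also have "(t - s) * \<alpha>1 ^ n + (t - s) * \<alpha>2 ^ n
        = real 2 * (t - s) * (\<integral>x. x ^ n \<partial>two_point_measure \<alpha>1 \<alpha>2)"
      by (simp add: moment_two_point_measure algebra_simps)
    finally show "kappa \<phi> n (a1 t - a1 s + (a2 t - a2 s))
        = complex_of_real (real 2 * (t - s) * (\<integral>x. x ^ n \<partial>two_point_measure \<alpha>1 \<alpha>2))" .
  next
    fix n :: nat and s t :: "nat \<Rightarrow> real"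
    assume *: "(\<forall>i<n. 0 \<le> s i \<and> s i < t i) \<and> disjoint_family_on (\<lambda>i. {s i..<t i}) {..<n}"
    then show "free_elements \<phi> {..<n} (\<lambda>i. a1 (t i) - a1 (s i) + (a2 (t i) - a2 (s i)))"
      by (intro free_elements_add[OF _ _ free'] free_incr P1 P2 in1 in2) auto
  qed
qed

end

lemma disjoint_family_on_consecutive:
  fixes t :: "nat \<Rightarrow> real"
  assumes "\<And>i. i < n \<Longrightarrow> t i < t (Suc i)"
  shows "disjoint_family_on (\<lambda>i. {t i..<t (Suc i)}) {..<n}"
proof -
  have mono: "t i \<le> t j" if "i \<le> j" "j \<le> n" for i j
    using that
  proof (induction rule: dec_induct)
    case (step m)
    then show ?case using assms[of m] by simp
  qed simp
  have "{t i..<t (Suc i)} \<inter> {t j..<t (Suc j)} = {}" if "i < j" "j < n" for i j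
    using mono[of "Suc i" j] that by auto
  then show ?thesis
    unfolding disjoint_family_on_def by (metis Int_commute lessThan_iff linorder_neqE_nat)
qed

lemma compound_free_poisson_imp_free_poisson:
  assumes fam: "compound_free_poisson_family_with \<phi> \<nu> k (\<lambda>s t. X t - X s)"
    and moments: "\<And>n. n \<ge> 1 \<Longrightarrow> (\<integral>x. x ^ n \<partial>\<nu>) = \<alpha> ^ n"
    and sa: "\<And>t. t \<ge> 0 \<Longrightarrow> adj (X t) = X t" and "X 0 = 0"
  shows "free_poisson_process_with \<phi> k \<alpha> X"
  unfolding free_poisson_process_with_def
proof (intro conjI allI impI sa \<open>X 0 = 0\<close>)
  fix n and t :: "nat \<Rightarrow> real" assume *: "0 \<le> t 0 \<and> (\<forall>i<n. t i < t (Suc i))"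
  have "0 \<le> t i" if "i \<le> n" for i
    using that
  proof (induction i)
    case (Suc i)
    then show ?case using * by (meson Suc_le_lessD less_imp_le order_trans)
  qed (use * in simp)
  then show "free_elements \<phi> {..<n} (\<lambda>i. X (t (Suc i)) - X (t i))"
    using fam * disjoint_family_on_consecutive[of n t]
    unfolding compound_free_poisson_family_with_def by auto
next
  fix s t :: real and n :: nat assume "0 \<le> s \<and> s < t" "1 \<le> n"
  then show "kappa \<phi> n (X t - X s) = complex_of_real (real k * (t - s) * \<alpha> ^ n)"
    using fam moments by (simp add: compound_free_poisson_family_with_def)
qed

text \<open>
  For a geometric sequence, the product of the first and third terms is the square of the second; for the
  power sums of \<open>a\<close> and \<open>b\<close> the difference of the two sides is \<open>a b (a - b)\<^sup>2\<close>.
\<close>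
lemma power_sums_scaled_geometric:
  fixes a b c \<beta> :: real
  assumes sums: "\<And>n. n \<ge> 1 \<Longrightarrow> c * \<beta> ^ n = a ^ n + b ^ n" and "a \<noteq> 0" "b \<noteq> 0"
  shows "a = b"
proof -
  have "(c * \<beta> ^ 1) * (c * \<beta> ^ 3) = (c * \<beta> ^ 2) * (c * \<beta> ^ 2)"
    by (simp add: power2_eq_square power3_eq_cube)
  then have "(a ^ 1 + b ^ 1) * (a ^ 3 + b ^ 3) = (a ^ 2 + b ^ 2) * (a ^ 2 + b ^ 2)"
    by (simp only: sums)
  then have "a * b * (a - b) ^ 2 = 0"
    by (simp add: power2_eq_square power3_eq_cube algebra_simps)
  then show ?thesis using assms(2,3) by simp
qed

theorem corollary3p8:
  fixes \<phi> :: "'a::complex_star_algebra \<Rightarrow> complex"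
    and a1 a2 :: "real \<Rightarrow> 'a"
    and \<alpha>1 \<alpha>2 :: real
  assumes "star_prob_space \<phi>"
    and "free_poisson_process \<phi> a1"
    and "free_poisson_process \<phi> a2"
    and "\<And>t n. t \<ge> 0 \<Longrightarrow> n \<ge> 1 \<Longrightarrow> kappa \<phi> n (a1 t) = complex_of_real (t * \<alpha>1 ^ n)"
    and "\<And>t n. t \<ge> 0 \<Longrightarrow> n \<ge> 1 \<Longrightarrow> kappa \<phi> n (a2 t) = complex_of_real (t * \<alpha>2 ^ n)"
    and "free_processes \<phi> a1 a2"
  shows "compound_free_poisson_process \<phi> (\<lambda>t. a1 t + a2 t) \<and>
    (\<alpha>1 \<noteq> 0 \<and> \<alpha>2 \<noteq> 0 \<longrightarrow>
      (free_poisson_process \<phi> (\<lambda>t. a1 t + a2 t) \<longleftrightarrow> \<alpha>1 = \<alpha>2))"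
proof -
  interpret star_prob_space \<phi> by (rule assms(1))
  let ?X = "\<lambda>t. a1 t + a2 t"
  have fam: "compound_free_poisson_family_with \<phi> (two_point_measure \<alpha>1 \<alpha>2) 2 (\<lambda>s t. ?X t - ?X s)"
    by (rule compound_free_poisson_sum[OF assms(2-6)])
  then have "compound_free_poisson_process \<phi> ?X"
    unfolding compound_free_poisson_process_def
    using real_distribution_two_point_measure compactly_supported_two_point_measure
    by (intro exI[of _ "two_point_measure \<alpha>1 \<alpha>2"] exI[of _ 2]) simp
  moreover have "free_poisson_process \<phi> ?X \<longleftrightarrow> \<alpha>1 = \<alpha>2" if "\<alpha>1 \<noteq> 0" "\<alpha>2 \<noteq> 0"
  proof
    assume "free_poisson_process \<phi> ?X"
    then obtain k \<beta> where "free_poisson_process_with \<phi> k \<beta> ?X"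
      unfolding free_poisson_process_def by blast
    then have "kappa \<phi> n (?X 1 - ?X 0) = complex_of_real (real k * (1 - 0) * \<beta> ^ n)" if "n \<ge> 1" for n
      using that unfolding free_poisson_process_with_def by (meson order_refl zero_less_one)
    moreover have "kappa \<phi> n (?X 1 - ?X 0) = complex_of_real (\<alpha>1 ^ n + \<alpha>2 ^ n)" if "n \<ge> 1" for n
    proof -
      have "kappa \<phi> n (?X 1 - ?X 0)
          = complex_of_real (real 2 * (1 - 0) * (\<integral>x. x ^ n \<partial>two_point_measure \<alpha>1 \<alpha>2))"
        using fam that unfolding compound_free_poisson_family_with_def
        by (meson order_refl zero_less_one)
      also have "real 2 * (1 - 0) * (\<integral>x. x ^ n \<partial>two_point_measure \<alpha>1 \<alpha>2) = \<alpha>1 ^ n + \<alpha>2 ^ n"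
        by (simp add: moment_two_point_measure)
      finally show ?thesis .
    qed
    ultimately have "real k * (1 - 0) * \<beta> ^ n = \<alpha>1 ^ n + \<alpha>2 ^ n" if "n \<ge> 1" for n
      using that by (metis of_real_eq_iff)
    then have "real k * \<beta> ^ n = \<alpha>1 ^ n + \<alpha>2 ^ n" if "n \<ge> 1" for n
      using that by simp
    then show "\<alpha>1 = \<alpha>2" using that by (rule power_sums_scaled_geometric)
  next
    assume eq: "\<alpha>1 = \<alpha>2"
    have "adj (?X t) = ?X t" if "t \<ge> 0" for t
      using assms(2,3) that
      by (auto simp: adj_add free_poisson_process_def free_poisson_process_with_def)
    moreover have "?X 0 = 0"
      using assms(2,3) by (auto simp: free_poisson_process_def free_poisson_process_with_def)
    ultimately have "free_poisson_process_with \<phi> 2 \<alpha>1 ?X"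
      by (intro compound_free_poisson_imp_free_poisson[OF fam]) (simp_all add: moment_two_point_measure eq)
    then show "free_poisson_process \<phi> ?X"
      unfolding free_poisson_process_def by (intro exI[of _ 2]) auto
  qed
  ultimately show ?thesis by blast
qed

end
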